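(* Let $d\ge2$, let $\mathcal{C}=\{Q_0,\dots,Q_{r-1}\}$ be a toric constellation with origin over $X=\mathbb{C}^d$, and let $P(\underline t)$ be the Poincaré series of the multi-index filtration on $\mathcal{O}_{\mathbb{C}^d,o}$ defined by the divisorial valuations $\nu_1,\dots,\nu_r$ of the exceptional components $E_1,\dots,E_r$. Let $\underline v_1,\dots,\underline v_d\in\mathbb{Z}^r$ be the column vectors of $\mathcal{L}(\mathcal{C})$ (listed with repetitions). Then $$P(\underline t)=\frac{1}{(1-\underline t^{\underline v_1})\cdots(1-\underline t^{\underline v_d})}.$$
   Context: Constellations: $X=X_0=\mathbb{C}^d$ has coordinates $x_1,\dots,x_d$ and carries the standard action of the torus $T=(\mathbb{C}^* )^d$; $o$ is the origin. A toric constellation with origin is a finite sequence $\mathcal{C}=\{Q_0,\dots,Q_{r-1}\}$, $r\ge 1$, where $Q_0=o\in X_0$, $X_j\to X_{j-1}$ is the blowing-up of the point $Q_{j-1}$ ($1\le j\le r$), and each $Q_j$ ($1\le j\le r-1$) is a $0$-dimensional $T$-orbit of $X_j$ mapping to $Q_0$. Put $Z=X_r$ and $\pi:Z\to X$ the composition. For $1\le j\le r$, $E_j\subset Z$ is the (strict transform in $Z$ of the) exceptional divisor of the blowing-up of $Q_{j-1}$, and $\nu_j$ is the discrete valuation on $\mathcal{O}_{\mathbb{C}^d,o}$ given by the order of vanishing of $\pi^*g$ along $E_j$ (a monomial valuation). $\underline\nu=(\nu_1,\dots,\nu_r)$. The matrix $\mathcal{L}(\mathcal{C})$: the $r\times d$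 matrix of the linear system $\langle s,\underline\nu\rangle=\underline v$ in the unknown $s$, i.e. its $(j,i)$ entry is $\nu_j(x_i)$; its $i$-th column is $\underline\nu(x_i)$. Poincaré series: for $\underline v\in\mathbb{Z}^r$ put $I(\underline v)=\{g\in\mathcal{O}_{\mathbb{C}^d,o}\mid \nu_i(g)\ge v_i,\ 1\le i\le r\}$, $\underline 1=(1,\dots,1)$, $d(\underline v)=\dim_{\mathbb C} I(\underline v)/I(\underline v+\underline 1)$ (finite), $L=\sum_{\underline v\in\mathbb{Z}^r}d(\underline v)\,\underline t^{\underline v}$. Then $\prod_{i=1}^r(t_i-1)L\in\mathbb{Z}[[t_1,\dots,t_r]]$ and $P(\underline t)=\prod_{i=1}^r(t_i-1)L/(t_1\cdots t_r-1)\in\mathbb{Z}[[t_1,\dots,t_r]]$. *)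

theory Defs
  imports "HOL-Analysis.Analysis" "HOL-Library.Poly_Mapping"
begin

section \<open>Analytic functions of several variables\<close>

definition analytic_at_pt :: "complex ^ 'd \<Rightarrow> (complex ^ 'd \<Rightarrow> complex) \<Rightarrow> bool" where
  "analytic_at_pt p f \<longleftrightarrow>
     (\<exists>(a :: nat ^ 'd \<Rightarrow> complex) \<rho>. 0 < \<rho> \<and>
        (\<forall>z. (\<forall>i. norm (z $ i) < \<rho>) \<longrightarrow>
           ((\<lambda>\<alpha>. a \<alpha> * (\<Prod>i\<in>UNIV. (z $ i) ^ (\<alpha> $ i))) has_sum f (p + z)) UNIV))"

text \<open>The germ of \<open>u\<close> at \<open>p\<close> generates the ideal of the germs at \<open>p\<close> of analytic functions
  that vanish on \<open>E\<close>.\<close>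

definition local_equation :: "(complex ^ 'd) set \<Rightarrow> complex ^ 'd \<Rightarrow> (complex ^ 'd \<Rightarrow> complex) \<Rightarrow> bool" where
  "local_equation E p u \<longleftrightarrow>
     analytic_at_pt p u \<and> (\<forall>\<^sub>F z in nhds p. z \<in> E \<longrightarrow> u z = 0) \<and>
     (\<forall>f. analytic_at_pt p f \<and> (\<forall>\<^sub>F z in nhds p. z \<in> E \<longrightarrow> f z = 0) \<longrightarrow>
        (\<exists>h. analytic_at_pt p h \<and> (\<forall>\<^sub>F z in nhds p. f z = u z * h z)))"

definition vanishes_to_order_at ::
  "(complex ^ 'd) set \<Rightarrow> complex ^ 'd \<Rightarrow> nat \<Rightarrow> (complex ^ 'd \<Rightarrow> complex) \<Rightarrow> bool" where
  "vanishes_to_order_at E p n f \<longleftrightarrow>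
     (\<exists>u h. local_equation E p u \<and> analytic_at_pt p h \<and> (\<forall>\<^sub>F z in nhds p. f z = u z ^ n * h z))"

section \<open>Iterated blow-ups of torus-fixed points\<close>

text \<open>The points of the varieties \<open>X\<^sub>j\<close>: a point of \<open>\<complex>\<^sup>d\<close>, or a point of the exceptional divisor
  \<open>\<P>(T\<^sub>q)\<close> of the blow-up of a point \<open>q\<close>, given by a line in the tangent space at \<open>q\<close>.
  Points other than \<open>q\<close> are identified with their preimage under the blow-up of \<open>q\<close>.\<close>

datatype 'a bl_point = Base 'a | Exc "'a bl_point" "'a set"

text \<open>The map to \<open>\<complex>\<^sup>d\<close>; on the points of any \<open>X\<^sub>j\<close> it is the composition of the blow-ups.\<close>

primrec blow_down :: "'a bl_point \<Rightarrow> 'a" where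
  "blow_down (Base x) = x"
| "blow_down (Exc q l) = blow_down q"

definition cline :: "complex ^ 'd \<Rightarrow> (complex ^ 'd) set" where
  "cline w = range (\<lambda>c. c *s w)"

text \<open>A chart \<open>(\<phi>, \<theta>)\<close> is a parametrization \<open>\<phi>\<close> of an open subset by \<open>\<complex>\<^sup>d\<close>, together with the
  characters \<open>\<theta> t $ i\<close> by which \<open>t \<in> T\<close> acts on its coordinates. A space is
  given by a set of charts covering it.\<close>

type_synonym 'd chart =
  "(complex ^ 'd \<Rightarrow> (complex ^ 'd) bl_point) \<times> (complex ^ 'd \<Rightarrow> complex ^ 'd)"

definition affine_space_charts :: "('d::finite) chart set" where
  "affine_space_charts = {(Base, id)}"

definition space_points :: "('d::finite) chart set \<Rightarrow> (complex ^ 'd) bl_point set" where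
  "space_points A = (\<Union>(\<phi>, \<theta>)\<in>A. range \<phi>)"

definition torus :: "(complex ^ 'd) set" where
  "torus = {t. \<forall>i. t $ i \<noteq> 0}"

definition torus_orbit :: "('d::finite) chart set \<Rightarrow> (complex ^ 'd) bl_point \<Rightarrow> (complex ^ 'd) bl_point set" where
  "torus_orbit A p =
     {\<phi> (\<chi> i. \<theta> t $ i * z $ i) | \<phi> \<theta> z t. (\<phi>, \<theta>) \<in> A \<and> \<phi> z = p \<and> t \<in> torus}"

text \<open>The \<open>k\<close>-th standard affine chart of the blow-up of the origin \<open>q = \<phi> 0\<close> of a chart:
  \<open>y\<^sub>k = z\<^sub>k\<close> and \<open>y\<^sub>i = z\<^sub>k z\<^sub>i\<close> for \<open>i \<noteq> k\<close>; the exceptional divisor is \<open>z\<^sub>k = 0\<close>.\<close>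

definition blowup_chart :: "'d \<Rightarrow> ('d::finite) chart \<Rightarrow> 'd chart" where
  "blowup_chart k c =
     (case c of (\<phi>, \<theta>) \<Rightarrow>
       ((\<lambda>z. if z $ k \<noteq> 0 then \<phi> (\<chi> i. if i = k then z $ k else z $ k * z $ i)
             else Exc (\<phi> 0) (cline (\<chi> i. if i = k then 1 else z $ i))),
        (\<lambda>t. \<chi> i. if i = k then \<theta> t $ k else \<theta> t $ i / \<theta> t $ k)))"

text \<open>Only meant for a torus-fixed point \<open>q\<close>: such a point is the origin of exactly one chart
  and lies in no other chart.\<close>

definition blowup :: "(complex ^ 'd) bl_point \<Rightarrow> ('d::finite) chart set \<Rightarrow> 'd chart set" where
  "blowup q A =
     {c \<in> A. q \<notin> range (fst c)} \<union> {blowup_chart k c | k c. c \<in> A \<and> fst c 0 = q}"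

definition iterated_blowup :: "(complex ^ 'd) bl_point list \<Rightarrow> ('d::finite) chart set" where
  "iterated_blowup C = foldl (\<lambda>A q. blowup q A) affine_space_charts C"

text \<open>The space \<open>X\<^sub>j\<close> is \<open>iterated_blowup (take j C)\<close>. As \<open>T\<close> is connected, the \<open>0\<close>-dimensional
  orbits are the one-point orbits.\<close>

definition toric_constellation :: "(complex ^ ('d::finite)) bl_point list \<Rightarrow> bool" where
  "toric_constellation C \<longleftrightarrow>
     C \<noteq> [] \<and> C ! 0 = Base 0 \<and>
     (\<forall>j. 1 \<le> j \<and> j < length C \<longrightarrow>
        C ! j \<in> space_points (iterated_blowup (take j C)) \<and>
        torus_orbit (iterated_blowup (take j C)) (C ! j) = {C ! j} \<and>
        blow_down (C ! j) = 0)"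

section \<open>The divisorial valuations and the filtration\<close>

text \<open>The strict transform in \<open>Z\<close> of the exceptional divisor over \<open>q\<close>, seen in the coordinates of a
  chart of \<open>Z\<close>: the closure of the set of points of that divisor that have not been blown up.
  Charts are open embeddings, so the closure can be taken in the chart.\<close>

definition strict_transform_in :: "('d::finite) chart \<Rightarrow> (complex ^ 'd) bl_point \<Rightarrow> (complex ^ 'd) set" where
  "strict_transform_in c q = closure {z. \<exists>l. fst c z = Exc q l}"

text \<open>Indices are shifted by one: \<open>divisorial_valuation C j\<close> belongs to the divisor created by
  blowing up \<open>C ! j\<close>, that is, it is \<open>\<nu>\<^bsub>j+1\<^esub>\<close>.\<close>

definition divisorial_valuation ::
  "(complex ^ ('d::finite)) bl_point list \<Rightarrow> nat \<Rightarrow> (complex ^ 'd \<Rightarrow> complex) \<Rightarrow> enat" where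
  "divisorial_valuation C j g =
     Sup {enat n | n. \<forall>c \<in> iterated_blowup C. \<forall>p \<in> strict_transform_in c (C ! j).
            vanishes_to_order_at (strict_transform_in c (C ! j)) p n (\<lambda>z. g (blow_down (fst c z)))}"

definition L_matrix :: "(complex ^ ('d::finite)) bl_point list \<Rightarrow> nat \<Rightarrow> 'd \<Rightarrow> nat" where
  "L_matrix C j i = the_enat (divisorial_valuation C j (\<lambda>x. x $ i))"

text \<open>Vectors in \<open>\<int>\<^sup>r\<close> are finitely supported functions with support in \<open>{..<r}\<close>.\<close>

type_synonym ivec = "nat \<Rightarrow>\<^sub>0 int"

definition int_vectors :: "nat \<Rightarrow> ivec set" where
  "int_vectors r = {v. Poly_Mapping.keys v \<subseteq> {..<r}}"

definition ones :: "nat \<Rightarrow> ivec" where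
  "ones r = (\<Sum>j<r. Poly_Mapping.single j 1)"

definition L_column :: "(complex ^ ('d::finite)) bl_point list \<Rightarrow> 'd \<Rightarrow> ivec" where
  "L_column C i = (\<Sum>j<length C. Poly_Mapping.single j (int (L_matrix C j i)))"

text \<open>Germs at the origin are represented by functions. Functions with the same germ have the
  same valuations, and each \<open>filtration_ideal C v\<close> contains all functions vanishing near \<open>0\<close>,
  so quotients of two of these spaces are the same as for germs. Valuations are nonnegative, so
  truncating negative \<open>v\<^sub>j\<close> to \<open>0\<close> does not change the condition.\<close>

definition filtration_ideal ::
  "(complex ^ ('d::finite)) bl_point list \<Rightarrow> ivec \<Rightarrow> (complex ^ 'd \<Rightarrow> complex) set" where
  "filtration_ideal C v =
     {g. analytic_at_pt 0 g \<and>
         (\<forall>j<length C. enat (nat (Poly_Mapping.lookup v j)) \<le> divisorial_valuation C j g)}"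

text \<open>The classes of the elements of \<open>B\<close> form a finite basis of \<open>I / J\<close>.\<close>

definition quotient_basis :: "('x \<Rightarrow> complex) set \<Rightarrow> ('x \<Rightarrow> complex) set \<Rightarrow> ('x \<Rightarrow> complex) set \<Rightarrow> bool" where
  "quotient_basis I J B \<longleftrightarrow>
     finite B \<and> B \<subseteq> I \<and>
     (\<forall>c. (\<lambda>x. \<Sum>b\<in>B. c b * b x) \<in> J \<longrightarrow> (\<forall>b\<in>B. c b = 0)) \<and>
     (\<forall>g\<in>I. \<exists>c. (\<lambda>x. g x - (\<Sum>b\<in>B. c b * b x)) \<in> J)"

definition quotient_dim :: "('x \<Rightarrow> complex) set \<Rightarrow> ('x \<Rightarrow> complex) set \<Rightarrow> nat" where
  "quotient_dim I J = (THE n. \<exists>B. quotient_basis I J B \<and> card B = n)"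

section \<open>Laurent polynomials, formal series and the Poincare series\<close>

text \<open>Laurent polynomials in the variables \<open>t\<^sub>j\<close> act on two-sided formal series, which are given by
  their coefficient functions.\<close>

type_synonym laurent_poly = "ivec \<Rightarrow>\<^sub>0 int"
type_synonym formal_series = "ivec \<Rightarrow> int"

definition t_pow :: "ivec \<Rightarrow> laurent_poly" where
  "t_pow v = Poly_Mapping.single v 1"

definition t_var :: "nat \<Rightarrow> laurent_poly" where
  "t_var j = t_pow (Poly_Mapping.single j 1)"

definition series_mult :: "laurent_poly \<Rightarrow> formal_series \<Rightarrow> formal_series" where
  "series_mult D F = (\<lambda>v. \<Sum>w\<in>Poly_Mapping.keys D. Poly_Mapping.lookup D w * F (v - w))"

definition nonneg_vectors :: "nat \<Rightarrow> ivec set" where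
  "nonneg_vectors r = {v \<in> int_vectors r. \<forall>j. 0 \<le> Poly_Mapping.lookup v j}"

text \<open>The set \<open>\<int>[[t\<^sub>1,\<dots>,t\<^sub>r]]\<close>.\<close>

definition power_series :: "nat \<Rightarrow> formal_series set" where
  "power_series r = {F. \<forall>v. F v \<noteq> 0 \<longrightarrow> v \<in> nonneg_vectors r}"

text \<open>The quotient \<open>F / D\<close> in \<open>\<int>[[t\<^sub>1,\<dots>,t\<^sub>r]]\<close>; see \<open>series_quotient_unique\<close> below.\<close>

definition series_quotient :: "nat \<Rightarrow> formal_series \<Rightarrow> laurent_poly \<Rightarrow> formal_series" where
  "series_quotient r F D = (THE G. G \<in> power_series r \<and> series_mult D G = F)"

definition L_series :: "(complex ^ ('d::finite)) bl_point list \<Rightarrow> formal_series" where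
  "L_series C = (\<lambda>v. if v \<in> int_vectors (length C)
     then int (quotient_dim (filtration_ideal C v) (filtration_ideal C (v + ones (length C)))) else 0)"

definition poincare_series :: "(complex ^ ('d::finite)) bl_point list \<Rightarrow> formal_series" where
  "poincare_series C =
     series_quotient (length C)
       (series_mult (\<Prod>j<length C. t_var j - 1) (L_series C))
       ((\<Prod>j<length C. t_var j) - 1)"

lemma series_quotient_unique:
  fixes D :: laurent_poly
  assumes D: "Poly_Mapping.keys D \<subseteq> nonneg_vectors r" "\<bar>Poly_Mapping.lookup D 0\<bar> = 1"
    and F: "F \<in> power_series r"
  shows "\<exists>!G. G \<in> power_series r \<and> series_mult D G = F"
proof -
  define s where "s = Poly_Mapping.lookup D 0"
  have s: "s * s = 1" "s \<noteq> 0" using D(2) by (auto simp: s_def abs_if split: if_splits)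
  define K where "K = Poly_Mapping.keys D - {0}"
  define dg where "dg = (\<lambda>v::ivec. nat (\<Sum>j<r. Poly_Mapping.lookup v j))"
  have K0: "Poly_Mapping.keys D = insert 0 K" "0 \<notin> K" "finite K"
    using s by (auto simp: K_def s_def in_keys_iff)
  have mult: "series_mult D G v = s * G v + (\<Sum>w\<in>K. Poly_Mapping.lookup D w * G (v - w))" for G v
    using K0 by (simp add: series_mult_def s_def)
  have dec: "dg (v - w) < dg v" if "w \<in> K" "v - w \<in> nonneg_vectors r" for v w
  proof -
    have w: "w \<in> nonneg_vectors r" "w \<noteq> 0" using that D(1) by (auto simp: K_def)
    then obtain j where j: "Poly_Mapping.lookup w j \<noteq> 0"
      by (metis poly_mapping_eqI lookup_zero)
    then have "j < r" using w by (auto simp: nonneg_vectors_def int_vectors_def in_keys_iff)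
    moreover have "0 \<le> Poly_Mapping.lookup w i" for i using w by (auto simp: nonneg_vectors_def)
    ultimately have "0 < (\<Sum>j<r. Poly_Mapping.lookup w j)"
      using j by (intro sum_pos2[of _ j]) (auto simp: order_le_less)
    moreover have "0 \<le> (\<Sum>j<r. Poly_Mapping.lookup (v - w) j)"
      using that by (intro sum_nonneg) (auto simp: nonneg_vectors_def)
    ultimately show ?thesis by (simp add: dg_def lookup_minus sum_subtractf)
  qed
  have nn: "v \<in> nonneg_vectors r" if "w \<in> K" "v - w \<in> nonneg_vectors r" for v w
  proof -
    have "w \<in> nonneg_vectors r" using that D(1) by (auto simp: K_def)
    with that(2) have "\<forall>j. 0 \<le> Poly_Mapping.lookup v j"
      and "\<forall>j. \<not> j < r \<longrightarrow> Poly_Mapping.lookup v j = 0"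
      unfolding nonneg_vectors_def int_vectors_def subset_iff in_keys_iff mem_Collect_eq lookup_minus
      by (smt (verit) lessThan_iff)+
    then show ?thesis
      by (auto simp: nonneg_vectors_def int_vectors_def in_keys_iff)
  qed
  let ?R = "inv_image less_than dg"
  let ?P = "\<lambda>G v x. x = (if v \<in> nonneg_vectors r then
     s * (F v - (\<Sum>w\<in>K. if v - w \<in> nonneg_vectors r then Poly_Mapping.lookup D w * G (v - w) else 0)) else 0)"
  have "\<exists>G. \<forall>v. ?P G v (G v)"
  proof (rule dependent_wf_choice[where R = ?R])
    show "wf ?R" by simp
    show "?P f v x = ?P g v x" if "\<And>w. (w, v) \<in> ?R \<Longrightarrow> f w = g w" for f g :: formal_series and v x
    proof -
      have "(\<Sum>w\<in>K. if v - w \<in> nonneg_vectors r then Poly_Mapping.lookup D w * f (v - w) else 0) =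
            (\<Sum>w\<in>K. if v - w \<in> nonneg_vectors r then Poly_Mapping.lookup D w * g (v - w) else 0)"
        using dec that by (intro sum.cong) auto
      then show ?thesis by simp
    qed
  qed auto
  then obtain G where G: "\<And>v. ?P G v (G v)" by blast
  have Gp: "G \<in> power_series r" unfolding power_series_def using G by auto
  have Gs: "(\<Sum>w\<in>K. if v - w \<in> nonneg_vectors r then Poly_Mapping.lookup D w * G (v - w) else 0) =
     (\<Sum>w\<in>K. Poly_Mapping.lookup D w * G (v - w))" for v
    using Gp by (intro sum.cong) (auto simp: power_series_def)
  have "series_mult D G v = F v" for v
  proof (cases "v \<in> nonneg_vectors r")
    case True
    then have "G v = s * (F v - (\<Sum>w\<in>K. Poly_Mapping.lookup D w * G (v - w)))"
      using G[of v] Gs[of v] by simp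
    then have "s * G v = F v - (\<Sum>w\<in>K. Poly_Mapping.lookup D w * G (v - w))"
      using s(1) by (metis mult.assoc mult_1)
    then show ?thesis by (simp add: mult)
  next
    case False
    then have "G v = 0" "F v = 0" "\<And>w. w \<in> K \<Longrightarrow> G (v - w) = 0"
      using Gp F nn by (auto simp: power_series_def)
    then show ?thesis by (simp add: mult)
  qed
  then have "G \<in> power_series r \<and> series_mult D G = F" using Gp by auto
  moreover have "H v = H' v"
    if H: "H \<in> power_series r \<and> series_mult D H = F" "H' \<in> power_series r \<and> series_mult D H' = F"
    for H H' v
  proof (induction "dg v" arbitrary: v rule: less_induct)
    case less
    have "H (v - w) = H' (v - w)" if "w \<in> K" for w
      using less[of "v - w"] dec[OF that, of v] H by (force simp: power_series_def)
    then have "(\<Sum>w\<in>K. Poly_Mapping.lookup D w * H (v - w)) = (\<Sum>w\<in>K. Poly_Mapping.lookup D w * H' (v - w))"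
      by simp
    moreover have "series_mult D H v = series_mult D H' v" using H by simp
    ultimately show ?case using s(2) by (simp add: mult)
  qed
  ultimately show ?thesis by blast
qed

end

theory Submission
  imports Defs
begin

text \<open>
  The reason for the formula is that every \<open>\<nu>\<^sub>j\<close> is a monomial valuation, so that the filtration can be
  read off from exponents. In each chart of \<open>Z\<close> the map to \<open>\<complex>\<^sup>d\<close> is monomial,
  \<open>x\<^sub>i = \<Prod>\<^sub>m z\<^sub>m^M\<^sub>i\<^sub>m\<close>, and \<open>E\<^sub>j\<close> is either absent or a coordinate hyperplane \<open>z\<^sub>k = 0\<close>. The
  column \<open>M\<^sub>i\<^sub>k\<close> does not depend on the chart: it is fixed when \<open>E\<^sub>j\<close> is created, as the row sums of the
  exponent matrix of the unique chart centred at the blown-up point, and later blow-ups leave it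
  alone. Call it \<open>w\<^sub>j\<close>. All its entries are positive because the point lies over the origin
  (\<open>toric_atlas_iterated_blowup\<close>).

  For a germ \<open>g = \<Sum> a\<^sub>\<alpha> x\<^sup>\<alpha>\<close>, the claim \<open>\<nu>\<^sub>j g = Min {\<langle>w\<^sub>j, \<alpha>\<rangle> | \<alpha>. a\<^sub>\<alpha> \<noteq> 0}\<close> has two halves. If all
  occurring \<open>\<alpha>\<close> satisfy \<open>n \<le> \<langle>w\<^sub>j, \<alpha>\<rangle>\<close>, the factor \<open>z\<^sub>k^n\<close> can be divided out termwise, and the
  quotient has to be re-expanded at an arbitrary point of the hyperplane, where the other coordinates
  need not vanish (\<open>pullback_vanishes\<close>). Conversely, vanishing to order \<open>n\<close> gives a growth bound
  \<open>O(\<bar>z\<^sub>k\<bar>^n)\<close> at the origin of a chart, and a Cauchy estimate on small polycircles forces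
  \<open>a\<^sub>\<alpha> = 0\<close> whenever \<open>\<langle>w\<^sub>j, \<alpha>\<rangle> < n\<close> (\<open>pullback_vanishes_only_if\<close>). The Cauchy estimate
  itself is obtained by averaging over roots of unity instead of integrating (\<open>cauchy_estimate\<close>).

  Consequently the monomials \<open>x\<^sup>\<alpha>\<close> with \<open>v \<le> W \<alpha>\<close> and \<open>v\<^sub>j = (W \<alpha>)\<^sub>j\<close> for some \<open>j\<close>, where
  \<open>W \<alpha> = (\<langle>w\<^sub>j, \<alpha>\<rangle>)\<^sub>j\<close>, represent a basis of \<open>I(v) / I(v + 1)\<close> (\<open>quotient_dim_filtration\<close>). Hence \<open>L\<close> is
  a sum over \<open>\<alpha>\<close> of \<open>H\<^sub>\<alpha>(v) - H\<^sub>\<alpha>(v + 1)\<close>, with \<open>H\<^sub>\<alpha>\<close> the indicator of the orthant \<open>v \<le> W \<alpha>\<close>. The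
  operator \<open>\<Prod>(t\<^sub>j - 1)\<close> turns \<open>H\<^sub>\<alpha>\<close> into the single monomial \<open>t^(W \<alpha> + 1)\<close>, so the contribution of
  \<open>\<alpha>\<close> becomes \<open>(t\<^sub>1 \<cdots> t\<^sub>r - 1) t^(W \<alpha>)\<close> and the Poincare series is \<open>\<Sum>\<^sub>\<alpha> t^(W \<alpha>)\<close>
  (\<open>poincare_numerator\<close>). As \<open>W\<close> is additive and sends the \<open>i\<close>-th unit vector to the \<open>i\<close>-th column of
  the matrix, this sum is the product of the geometric series (\<open>series_mult_geometric\<close>).
\<close>

section \<open>Power series in several variables\<close>

definition mpow :: "complex ^ 'd \<Rightarrow> nat ^ 'd \<Rightarrow> complex" where
  "mpow z \<alpha> = (\<Prod>i\<in>UNIV. (z $ i) ^ (\<alpha> $ i))"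

text \<open>The polydisc radius is kept explicit because sums of expansions and comparisons of coefficients
  need a common domain.\<close>

definition expansion_at ::
  "complex ^ 'd \<Rightarrow> (complex ^ 'd \<Rightarrow> complex) \<Rightarrow> (nat ^ 'd \<Rightarrow> complex) \<Rightarrow> real \<Rightarrow> bool" where
  "expansion_at p f a \<rho> \<longleftrightarrow> 0 < \<rho> \<and>
     (\<forall>z. (\<forall>i. norm (z $ i) < \<rho>) \<longrightarrow> ((\<lambda>\<alpha>. a \<alpha> * mpow z \<alpha>) has_sum f (p + z)) UNIV)"

lemma expansion_atD:
  assumes "expansion_at p f a \<rho>"
  shows "0 < \<rho>" and "(\<And>i. norm (z $ i) < \<rho>) \<Longrightarrow> ((\<lambda>\<alpha>. a \<alpha> * mpow z \<alpha>) has_sum f (p + z)) UNIV"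
  using assms by (auto simp: expansion_at_def)

lemma analytic_iff_expansion: "analytic_at_pt p f \<longleftrightarrow> (\<exists>a \<rho>. expansion_at p f a \<rho>)"
  by (simp add: analytic_at_pt_def expansion_at_def mpow_def)

lemma eventually_nhds_polydisc:
  fixes p :: "complex ^ 'd::finite"
  shows "(\<forall>\<^sub>F z in nhds p. P z) \<longleftrightarrow> (\<exists>\<epsilon>>0. \<forall>z. (\<forall>i. norm (z $ i) < \<epsilon>) \<longrightarrow> P (p + z))"
proof
  assume "\<forall>\<^sub>F z in nhds p. P z"
  then obtain e where e: "e > 0" "\<And>z. dist z p < e \<Longrightarrow> P z"
    by (auto simp: eventually_nhds_metric)
  define \<epsilon> where "\<epsilon> = e / real CARD('d)"
  have "norm z < e" if "\<forall>i. norm (z $ i) < \<epsilon>" for z :: "complex ^ 'd"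
  proof -
    have "norm z \<le> (\<Sum>i\<in>UNIV. norm (z $ i))"
      unfolding norm_vec_def by (rule L2_set_le_sum) auto
    also have "\<dots> < (\<Sum>i\<in>(UNIV :: 'd set). \<epsilon>)" using that by (intro sum_strict_mono) auto
    also have "\<dots> = e" by (simp add: \<epsilon>_def)
    finally show ?thesis .
  qed
  then show "\<exists>\<epsilon>>0. \<forall>z. (\<forall>i. norm (z $ i) < \<epsilon>) \<longrightarrow> P (p + z)"
    using e by (intro exI[of _ \<epsilon>]) (auto simp: \<epsilon>_def dist_norm)
next
  assume "\<exists>\<epsilon>>0. \<forall>z. (\<forall>i. norm (z $ i) < \<epsilon>) \<longrightarrow> P (p + z)"
  then obtain \<epsilon> where \<epsilon>: "\<epsilon> > 0" "\<And>z. \<forall>i. norm (z $ i) < \<epsilon> \<Longrightarrow> P (p + z)" by blast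
  have "P z" if "dist z p < \<epsilon>" for z
  proof -
    have "norm ((z - p) $ i) < \<epsilon>" for i
      using Finite_Cartesian_Product.norm_nth_le[of "z - p" i] that by (simp add: dist_norm)
    then show ?thesis using \<epsilon>(2)[of "z - p"] by simp
  qed
  then show "\<forall>\<^sub>F z in nhds p. P z" using \<epsilon>(1) by (auto simp: eventually_nhds_metric)
qed

lemma norm_mpow: "norm (mpow z \<alpha>) = (\<Prod>i\<in>UNIV. norm (z $ i) ^ (\<alpha> $ i))"
  by (simp add: mpow_def prod_norm[symmetric] norm_power)

lemma has_sum_sum:
  fixes f :: "'g \<Rightarrow> 'b \<Rightarrow> 'c :: topological_comm_monoid_add"
  assumes "finite G" "\<And>g. g \<in> G \<Longrightarrow> (f g has_sum s g) A"
  shows "((\<lambda>x. \<Sum>g\<in>G. f g x) has_sum (\<Sum>g\<in>G. s g)) A"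
  using assms by (induction G rule: finite_induct) (auto intro!: has_sum_add)

text \<open>Orthogonality of the characters of the group of \<open>N\<close>-th roots of unity.\<close>

lemma power_root_of_unity_sum:
  fixes N :: nat
  assumes "N \<ge> 1"
  defines "\<omega> \<equiv> exp (2 * of_real pi * \<i> / of_nat N) :: complex"
  shows "(\<Sum>t<N. (\<omega> ^ j) ^ t) = (if N dvd j then of_nat N else 0)" and "norm \<omega> = 1" and "\<omega> ^ N = 1"
proof -
  have pw: "\<omega> ^ j = exp (2 * of_real pi * \<i> * of_nat j / of_nat N)" for j
    unfolding \<omega>_def exp_of_nat_mult[symmetric] by (simp add: mult_ac)
  have one: "\<omega> ^ j = 1 \<longleftrightarrow> N dvd j" for j
    unfolding pw using complex_root_unity_eq_1[OF assms(1)] .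
  show N1: "\<omega> ^ N = 1" using one by simp
  show "norm \<omega> = 1" by (simp add: \<omega>_def)
  show "(\<Sum>t<N. (\<omega> ^ j) ^ t) = (if N dvd j then of_nat N else 0)"
  proof (cases "N dvd j")
    case True
    then have "\<omega> ^ j = 1" using one by simp
    then show ?thesis using True by (simp only: power_one sum_constant) simp
  next
    case False
    then have "\<omega> ^ j \<noteq> 1" using one by simp
    moreover have "(\<omega> ^ j) ^ N = 1" by (metis N1 power_commutes power_mult power_one mult.commute)
    ultimately show ?thesis using False by (simp add: geometric_sum)
  qed
qed

text \<open>Averaging \<open>F(z) z\<^bsup>-\<alpha>\<^esup>\<close> over the \<open>N\<close>-th roots of unity in each variable annihilates every \<open>\<beta>\<close> that is not
  congruent to \<open>\<alpha>\<close> modulo \<open>N\<close>. For large \<open>N\<close> the surviving \<open>\<beta> \<noteq> \<alpha>\<close> lie in the tail of an absolutely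
  convergent series, so the average is as close to the \<open>\<alpha>\<close>-th term as desired. No integration over
  the torus is involved. The radii may vary with the variable, which matters because the image of a
  polycircle under a monomial map has unequal radii.\<close>

lemma cauchy_estimate:
  fixes a :: "nat ^ 'd::finite \<Rightarrow> complex" and R :: "'d \<Rightarrow> real"
  assumes F: "\<And>z. (\<forall>i. norm (z $ i) = R i) \<Longrightarrow> ((\<lambda>\<alpha>. a \<alpha> * mpow z \<alpha>) has_sum F z) UNIV"
    and R: "\<And>i. 0 \<le> R i"
    and B: "\<And>z. (\<forall>i. norm (z $ i) = R i) \<Longrightarrow> norm (F z) \<le> B"
  shows "norm (a \<alpha>) * (\<Prod>i\<in>UNIV. R i ^ (\<alpha> $ i)) \<le> B"
proof (rule field_le_epsilon)
  fix e :: real assume e: "e > 0"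
  define r :: "complex ^ 'd" where "r = (\<chi> i. of_real (R i))"
  have nr: "norm (mpow r \<beta>) = (\<Prod>i\<in>UNIV. R i ^ (\<beta> $ i))" for \<beta>
    using R by (simp add: norm_mpow r_def)
  define b where "b = (\<lambda>\<beta>. norm (a \<beta> * mpow r \<beta>))"
  have "(\<lambda>\<beta>. a \<beta> * mpow r \<beta>) summable_on UNIV"
    using F[of r] R unfolding summable_on_def by (auto simp: r_def)
  then have "b summable_on UNIV"
    unfolding summable_on_iff_abs_summable_on_complex b_def .
  then obtain T where T: "(b has_sum T) UNIV" by (auto simp: summable_on_def)
  obtain S' where S': "finite S'" "dist (sum b S') T \<le> e"
    using has_sum_finite_approximation[OF T e] by blast
  define S where "S = insert \<alpha> S'"
  have S: "finite S" "\<alpha> \<in> S" "T - sum b S \<le> e"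
  proof -
    have "sum b S' \<le> sum b S" using S' by (intro sum_mono2) (auto simp: S_def b_def)
    then show "T - sum b S \<le> e" using S' by (auto simp: dist_real_def)
  qed (auto simp: S_def S')
  have "finite (\<Union>\<beta>\<in>S. range (\<lambda>i. \<beta> $ i))" using S by auto
  from finite_nat_bounded[OF this]
  obtain N0 where N0: "(\<Union>\<beta>\<in>S. range (\<lambda>i. \<beta> $ i)) \<subseteq> {..<N0}" by (elim exE)
  define N where "N = Suc N0"
  have N: "N \<ge> 1" "\<And>\<beta> i. \<beta> \<in> S \<Longrightarrow> \<beta> $ i < N"
  proof -
    show "\<beta> $ i < N" if "\<beta> \<in> S" for \<beta> i
    proof -
      have "\<beta> $ i \<in> (\<Union>\<beta>\<in>S. range (\<lambda>i. \<beta> $ i))" using that by blast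
      then have "\<beta> $ i < N0" using N0 by (meson lessThan_iff subsetD)
      then show ?thesis by (simp add: N_def)
    qed
  qed (simp add: N_def)
  define \<omega> where "\<omega> = exp (2 * of_real pi * \<i> / of_nat N)"
  note \<omega> = power_root_of_unity_sum[OF N(1), folded \<omega>_def]
  define G where "G = PiE (UNIV :: 'd set) (\<lambda>_. {..<N})"
  have G: "finite G" "card G = N ^ CARD('d)" by (auto simp: G_def card_PiE finite_PiE)
  define z :: "('d \<Rightarrow> nat) \<Rightarrow> complex ^ 'd" where "z = (\<lambda>g. \<chi> i. of_real (R i) * \<omega> ^ g i)"
  \<comment> \<open>\<open>\<omega> ^ (N - 1)\<close> is the inverse of \<open>\<omega>\<close>, so \<open>c g\<close> is the value of the character with exponent \<open>- \<alpha>\<close>.\<close>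
  define c where "c = (\<lambda>g. \<Prod>i\<in>UNIV. \<omega> ^ (g i * ((N - 1) * \<alpha> $ i)))"
  define K where "K = (\<lambda>\<beta>::nat^'d. \<Prod>i\<in>UNIV. \<Sum>t<N. (\<omega> ^ (\<beta> $ i + (N - 1) * \<alpha> $ i)) ^ t)"
  have z: "\<forall>i. norm (z g $ i) = R i" for g
    using R \<omega>(2) by (simp add: z_def norm_mult norm_power)
  have nc: "norm (c g) = 1" for g
    using \<omega>(2) by (simp add: c_def prod_norm[symmetric] norm_power)
  have avg: "(\<Sum>g\<in>G. c g * (a \<beta> * mpow (z g) \<beta>)) = a \<beta> * mpow r \<beta> * K \<beta>" for \<beta>
  proof -
    have "K \<beta> = (\<Sum>g\<in>G. \<Prod>i\<in>UNIV. (\<omega> ^ (\<beta> $ i + (N - 1) * \<alpha> $ i)) ^ g i)"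
      unfolding K_def G_def by (rule prod_sum_PiE) auto
    moreover have "c g * mpow (z g) \<beta> = mpow r \<beta> * (\<Prod>i\<in>UNIV. (\<omega> ^ (\<beta> $ i + (N - 1) * \<alpha> $ i)) ^ g i)" for g
      unfolding c_def mpow_def z_def r_def prod.distrib[symmetric]
      by (rule prod.cong)
        (simp_all add: power_mult_distrib power_add power_mult[symmetric] mult_ac)
    ultimately show ?thesis
      by (simp add: sum_distrib_left mult.left_commute mult.assoc)
  qed
  define Q where "Q = (\<Sum>g\<in>G. c g * F (z g))"
  have Q: "((\<lambda>\<beta>. a \<beta> * mpow r \<beta> * K \<beta>) has_sum Q) UNIV"
    unfolding avg[symmetric] Q_def
    by (intro has_sum_sum G has_sum_cmult_right F z)
  have nQ: "norm Q \<le> real N ^ CARD('d) * B"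
  proof -
    have "norm Q \<le> (\<Sum>g\<in>G. norm (c g * F (z g)))" unfolding Q_def by (rule norm_sum)
    also have "\<dots> \<le> (\<Sum>g\<in>G. B)" by (rule sum_mono) (simp add: norm_mult nc B z)
    finally show ?thesis by (simp add: G)
  qed
  have nK: "norm (K \<beta>) \<le> real N ^ CARD('d)" for \<beta>
  proof -
    have "norm (K \<beta>) \<le> (\<Prod>i\<in>(UNIV :: 'd set). real N)"
      unfolding K_def prod_norm[symmetric] \<omega>(1) by (intro prod_mono) auto
    then show ?thesis by simp
  qed
  have K\<alpha>: "K \<alpha> = of_nat N ^ CARD('d)"
  proof -
    have "x + (N - 1) * x = N * x" for x using N(1) by (cases N) auto
    then have "N dvd x + (N - 1) * x" for x by simp
    then show ?thesis unfolding K_def \<omega>(1) by simp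
  qed
  have K0: "K \<beta> = 0" if \<beta>: "\<beta> \<in> S" "\<beta> \<noteq> \<alpha>" for \<beta>
  proof -
    obtain i where i: "\<beta> $ i \<noteq> \<alpha> $ i" using \<beta>(2) by (auto simp: vec_eq_iff)
    have "\<not> N dvd \<beta> $ i + (N - 1) * \<alpha> $ i"
    proof
      assume "N dvd \<beta> $ i + (N - 1) * \<alpha> $ i"
      then have "int N dvd int (\<beta> $ i + (N - 1) * \<alpha> $ i)" by (simp only: of_nat_dvd_iff)
      then have "int N dvd int (\<beta> $ i) + (int N - 1) * int (\<alpha> $ i)" using N(1) by (simp add: of_nat_diff)
      then have "int N dvd (int (\<beta> $ i) + (int N - 1) * int (\<alpha> $ i)) - int N * int (\<alpha> $ i)" by (rule dvd_diff) simp
      then have "int N dvd int (\<beta> $ i) - int (\<alpha> $ i)" by (simp add: algebra_simps)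
      then show False
        using i N(2)[OF \<beta>(1), of i] N(2)[OF S(2), of i] zdvd_not_zless
        by (smt (verit) of_nat_eq_iff of_nat_less_iff dvd_diff_commute of_nat_0_le_iff)
    qed
    then show ?thesis unfolding K_def \<omega>(1) by (intro prod_zero) auto
  qed
  have "(\<Sum>\<beta>\<in>S. a \<beta> * mpow r \<beta> * K \<beta>) = (\<Sum>\<beta>\<in>{\<alpha>}. a \<beta> * mpow r \<beta> * K \<beta>)"
    using S K0 by (intro sum.mono_neutral_right) auto
  then have rest: "((\<lambda>\<beta>. a \<beta> * mpow r \<beta> * K \<beta>) has_sum (Q - a \<alpha> * mpow r \<alpha> * K \<alpha>)) (UNIV - S)"
    using has_sum_Diff[OF Q has_sum_finite[OF S(1)]] by simp
  have "((\<lambda>\<beta>. b \<beta> * real N ^ CARD('d)) has_sum ((T - sum b S) * real N ^ CARD('d))) (UNIV - S)"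
    by (intro has_sum_cmult_left has_sum_Diff T has_sum_finite S) auto
  from norm_infsum_le[OF rest this]
  have "norm (Q - a \<alpha> * mpow r \<alpha> * K \<alpha>) \<le> (T - sum b S) * real N ^ CARD('d)"
    using nK by (simp add: b_def norm_mult mult_left_mono)
  also have "\<dots> \<le> e * real N ^ CARD('d)" using S by (intro mult_right_mono) auto
  finally have "norm (a \<alpha> * mpow r \<alpha> * K \<alpha>) \<le> (B + e) * real N ^ CARD('d)"
    using nQ norm_triangle_sub[of "a \<alpha> * mpow r \<alpha> * K \<alpha>" Q]
    by (simp add: norm_minus_commute algebra_simps)
  then have "norm (a \<alpha>) * norm (mpow r \<alpha>) * real N ^ CARD('d) \<le> (B + e) * real N ^ CARD('d)"
    by (simp add: norm_mult K\<alpha> norm_power)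
  then show "norm (a \<alpha>) * (\<Prod>i\<in>UNIV. R i ^ (\<alpha> $ i)) \<le> B + e"
    using N(1) by (simp add: nr)
qed

lemma expansion_at_zero:
  fixes a :: "nat ^ 'd::finite \<Rightarrow> complex"
  assumes f: "expansion_at p f a \<rho>" and 0: "\<forall>\<^sub>F z in nhds p. f z = 0"
  shows "a \<alpha> = 0"
proof -
  obtain \<epsilon> where \<epsilon>: "\<epsilon> > 0" "\<And>z. \<forall>i. norm (z $ i) < \<epsilon> \<Longrightarrow> f (p + z) = 0"
    using 0 by (auto simp: eventually_nhds_polydisc)
  define r where "r = min \<rho> \<epsilon> / 2"
  have r: "0 < r" "r < \<rho>" "r < \<epsilon>" using f \<epsilon> by (auto simp: r_def expansion_at_def)
  have "norm (a \<alpha>) * (\<Prod>i\<in>(UNIV :: 'd set). r ^ (\<alpha> $ i)) \<le> 0"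
  proof (rule cauchy_estimate[where F = "\<lambda>z. f (p + z)"])
    show "((\<lambda>\<alpha>. a \<alpha> * mpow z \<alpha>) has_sum f (p + z)) UNIV" if "\<forall>i. norm (z $ i) = r" for z
      using that r by (intro expansion_atD(2)[OF f]) auto
    show "norm (f (p + z)) \<le> 0" if "\<forall>i. norm (z $ i) = r" for z
      using that r \<epsilon>(2)[of z] by auto
  qed (use r in auto)
  moreover have "(\<Prod>i\<in>(UNIV :: 'd set). r ^ (\<alpha> $ i)) > 0" using r by (intro prod_pos) auto
  ultimately show ?thesis by (simp add: mult_le_0_iff)
qed

lemma expansion_at_abs_summable:
  assumes f: "expansion_at p f a \<rho>" and r: "\<And>i. 0 \<le> r i" "\<And>i. r i < \<rho>"
  shows "(\<lambda>\<alpha>. norm (a \<alpha>) * (\<Prod>i\<in>UNIV. r i ^ (\<alpha> $ i))) summable_on UNIV"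
proof -
  define z :: "complex ^ 'a" where "z = (\<chi> i. of_real (r i))"
  have "((\<lambda>\<alpha>. a \<alpha> * mpow z \<alpha>) has_sum f (p + z)) UNIV"
    using r by (intro expansion_atD(2)[OF f]) (simp add: z_def)
  then have "(\<lambda>\<alpha>. a \<alpha> * mpow z \<alpha>) summable_on UNIV" by (rule has_sum_imp_summable)
  then have "(\<lambda>\<alpha>. norm (a \<alpha> * mpow z \<alpha>)) summable_on UNIV"
    unfolding summable_on_iff_abs_summable_on_complex .
  then show ?thesis using r by (simp add: norm_mult norm_mpow z_def)
qed

lemma analytic_imp_bounded:
  fixes p :: "complex ^ 'd::finite"
  assumes "analytic_at_pt p f"
  shows "\<exists>K. \<forall>\<^sub>F z in nhds p. norm (f z) \<le> K"
proof -
  obtain a \<rho> where f: "expansion_at p f a \<rho>" using assms by (auto simp: analytic_iff_expansion)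
  then have \<rho>: "\<rho> > 0" by (simp add: expansion_at_def)
  define b where "b = (\<lambda>\<alpha>. norm (a \<alpha>) * (\<Prod>i\<in>UNIV. (\<rho> / 2) ^ (\<alpha> $ i)))"
  have "b summable_on UNIV"
    unfolding b_def by (rule expansion_at_abs_summable[OF f]) (use \<rho> in auto)
  then obtain K where K: "(b has_sum K) UNIV" by (auto simp: summable_on_def)
  have "norm (f (p + z)) \<le> K" if z: "\<forall>i. norm (z $ i) < \<rho> / 2" for z
  proof (rule norm_infsum_le[OF _ K])
    show "((\<lambda>\<alpha>. a \<alpha> * mpow z \<alpha>) has_sum f (p + z)) UNIV"
    proof (rule expansion_atD(2)[OF f])
      show "norm (z $ i) < \<rho>" for i using z[rule_format, of i] \<rho> by simp
    qed
    show "norm (a \<alpha> * mpow z \<alpha>) \<le> b \<alpha>" for \<alpha>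
      unfolding norm_mult norm_mpow b_def
      using z by (intro mult_left_mono prod_mono conjI power_mono) (auto simp: less_imp_le)
  qed
  then show ?thesis using \<rho> unfolding eventually_nhds_polydisc by (intro exI[of _ K] exI[of _ "\<rho> / 2"]) auto
qed

section \<open>Order of vanishing along a coordinate hyperplane\<close>

lemma prod_power_add_axis:
  fixes r :: "'d::finite \<Rightarrow> 'a::comm_monoid_mult"
  shows "(\<Prod>i\<in>UNIV. r i ^ ((\<alpha> + axis k 1) $ i)) = (\<Prod>i\<in>UNIV. r i ^ (\<alpha> $ i)) * r k"
proof -
  have "(\<Prod>i\<in>UNIV. r i ^ (axis k 1 $ i)) = (\<Prod>i\<in>UNIV. if i = k then r i else 1)"
    by (rule prod.cong) (auto simp: axis_def)
  then show ?thesis by (simp add: power_add prod.distrib)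
qed

lemma expansion_at_mpow: "expansion_at 0 (\<lambda>z. mpow z \<beta>) (\<lambda>\<alpha>. if \<alpha> = \<beta> then 1 else 0) 1"
proof -
  have "((\<lambda>\<alpha>. (if \<alpha> = \<beta> then 1 else 0) * mpow z \<alpha>) has_sum mpow z \<beta>) UNIV" for z
    by (rule has_sum_finite_neutralI[where B = "{\<beta>}"]) auto
  then show ?thesis by (simp add: expansion_at_def)
qed

lemma mpow_axis: "mpow z (axis k 1) = z $ k"
  using prod_power_add_axis[of "\<lambda>i. z $ i" 0 k] by (simp add: mpow_def)

lemma coordinate_analytic:
  assumes "p $ k = 0"
  shows "analytic_at_pt p (\<lambda>z. z $ k)"
proof -
  have "expansion_at p (\<lambda>z. z $ k) (\<lambda>\<alpha>. if \<alpha> = axis k 1 then 1 else 0) 1"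
    using expansion_at_mpow[of "axis k 1"] assms by (simp add: expansion_at_def mpow_axis del: One_nat_def)
  then show ?thesis by (auto simp: analytic_iff_expansion)
qed

text \<open>Substituting \<open>z\<^sub>k = 0\<close> in the power series keeps exactly the terms with \<open>\<alpha>\<^sub>k = 0\<close>. The result
  vanishes near \<open>p\<close>, so these coefficients are zero and the exponent of \<open>z\<^sub>k\<close> can be lowered by one
  in all others.\<close>

lemma divisible_by_coordinate:
  fixes p :: "complex ^ 'd::finite"
  assumes f: "analytic_at_pt p f" and p: "p $ k = 0"
    and 0: "\<forall>\<^sub>F z in nhds p. z $ k = 0 \<longrightarrow> f z = 0"
  shows "\<exists>h. analytic_at_pt p h \<and> (\<forall>\<^sub>F z in nhds p. f z = z $ k * h z)"
proof -
  obtain a \<rho> where a: "expansion_at p f a \<rho>" using f by (auto simp: analytic_iff_expansion)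
  note \<rho> = expansion_atD(1)[OF a]
  define upd :: "complex ^ 'd \<Rightarrow> complex ^ 'd" where "upd = (\<lambda>z. \<chi> i. if i = k then 0 else z $ i)"
  have upd: "upd (p + z) = p + upd z" for z using p by (auto simp: upd_def vec_eq_iff)
  have updn: "norm (upd z $ i) \<le> norm (z $ i)" for z i by (simp add: upd_def)
  have a0: "a \<alpha> = 0" if "\<alpha> $ k = 0" for \<alpha>
  proof -
    let ?a = "\<lambda>\<alpha>. if \<alpha> $ k = 0 then a \<alpha> else 0"
    have "expansion_at p (\<lambda>z. f (upd z)) ?a \<rho>"
      unfolding expansion_at_def
    proof (intro conjI \<rho> allI impI)
      fix z :: "complex ^ 'd" assume z: "\<forall>i. norm (z $ i) < \<rho>"
      have "((\<lambda>\<alpha>. a \<alpha> * mpow (upd z) \<alpha>) has_sum f (p + upd z)) UNIV"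
        using z updn by (intro expansion_atD(2)[OF a]) (metis le_less_trans)
      moreover have "a \<alpha> * mpow (upd z) \<alpha> = ?a \<alpha> * mpow z \<alpha>" for \<alpha>
      proof (cases "\<alpha> $ k = 0")
        case True
        then have "mpow (upd z) \<alpha> = mpow z \<alpha>"
          unfolding mpow_def by (intro prod.cong) (auto simp: upd_def)
        then show ?thesis using True by simp
      next
        case False
        then have "mpow (upd z) \<alpha> = 0"
          unfolding mpow_def by (intro prod_zero) (auto simp: upd_def)
        then show ?thesis using False by simp
      qed
      ultimately show "((\<lambda>\<alpha>. ?a \<alpha> * mpow z \<alpha>) has_sum f (upd (p + z))) UNIV" by (simp add: upd)
    qed
    moreover have "\<forall>\<^sub>F z in nhds p. f (upd z) = 0"
    proof -
      obtain \<epsilon> where \<epsilon>: "\<epsilon> > 0" "\<And>z. \<forall>i. norm (z $ i) < \<epsilon> \<Longrightarrow> (p + z) $ k = 0 \<Longrightarrow> f (p + z) = 0"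
        using 0 unfolding eventually_nhds_polydisc by blast
      have "f (upd (p + z)) = 0" if "\<forall>i. norm (z $ i) < \<epsilon>" for z
        unfolding upd
      proof (rule \<epsilon>(2))
        show "\<forall>i. norm (upd z $ i) < \<epsilon>" using that updn by (metis le_less_trans)
      qed (simp add: p upd_def)
      then show ?thesis using \<epsilon>(1) unfolding eventually_nhds_polydisc by blast
    qed
    ultimately show ?thesis using expansion_at_zero[of p _ ?a \<rho> \<alpha>] that by auto
  qed
  define b where "b = (\<lambda>\<alpha>. a (\<alpha> + axis k 1))"
  have bs: "(\<lambda>\<alpha>. b \<alpha> * mpow z \<alpha>) summable_on UNIV" if z: "\<And>i. norm (z $ i) < \<rho>" for z
  proof -
    \<comment> \<open>The radius in the variable \<open>k\<close> has to be positive to be cancelled, even if \<open>z\<^sub>k = 0\<close>.\<close>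
    define r where "r = (\<lambda>i. if i = k then (norm (z $ k) + \<rho>) / 2 else norm (z $ i))"
    have r: "0 \<le> r i" "r i < \<rho>" "norm (z $ i) \<le> r i" for i
      using z[of i] \<rho> by (auto simp: r_def)
    have rk: "r k > 0" using \<rho> by (simp add: r_def add_nonneg_pos)
    have "(\<lambda>\<alpha>. norm (a \<alpha>) * (\<Prod>i\<in>UNIV. r i ^ (\<alpha> $ i))) summable_on range (\<lambda>\<alpha>. \<alpha> + axis k 1)"
      by (rule summable_on_subset_banach[OF expansion_at_abs_summable[OF a r(1,2)]]) auto
    then have "(\<lambda>\<alpha>. norm (b \<alpha>) * ((\<Prod>i\<in>UNIV. r i ^ (\<alpha> $ i)) * r k)) summable_on UNIV"
      by (subst (asm) summable_on_reindex)
        (auto simp: inj_on_def o_def b_def prod_power_add_axis simp del: vector_add_component One_nat_def)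
    then have "(\<lambda>\<alpha>. norm (b \<alpha>) * ((\<Prod>i\<in>UNIV. r i ^ (\<alpha> $ i)) * r k) * inverse (r k)) summable_on UNIV"
      by (rule summable_on_cmult_left)
    then have "(\<lambda>\<alpha>. norm (b \<alpha>) * (\<Prod>i\<in>UNIV. r i ^ (\<alpha> $ i))) summable_on UNIV"
      using rk by (simp add: mult.assoc)
    then have "(\<lambda>\<alpha>. norm (b \<alpha> * mpow z \<alpha>)) summable_on UNIV"
    proof (rule Infinite_Sum.abs_summable_on_comparison_test')
      show "norm (b \<alpha> * mpow z \<alpha>) \<le> norm (b \<alpha>) * (\<Prod>i\<in>UNIV. r i ^ (\<alpha> $ i))" for \<alpha>
        unfolding norm_mult norm_mpow using r
        by (intro mult_left_mono prod_mono conjI power_mono) auto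
    qed
    then show ?thesis by (rule abs_summable_summable)
  qed
  define h where "h = (\<lambda>w. \<Sum>\<^sub>\<infinity>\<alpha>. b \<alpha> * mpow (w - p) \<alpha>)"
  have h: "expansion_at p h b \<rho>"
    unfolding expansion_at_def h_def using \<rho> bs by (auto intro!: has_sum_infsum)
  have "f (p + z) = (p + z) $ k * h (p + z)" if z: "\<forall>i. norm (z $ i) < \<rho>" for z
  proof -
    have "((\<lambda>\<alpha>. a \<alpha> * mpow z \<alpha>) has_sum f (p + z)) UNIV"
      using z by (intro expansion_atD(2)[OF a]) auto
    also have "?this \<longleftrightarrow> ((\<lambda>\<alpha>. a \<alpha> * mpow z \<alpha>) has_sum f (p + z)) (range (\<lambda>\<alpha>. \<alpha> + axis k 1))"
    proof (rule has_sum_cong_neutral)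
      fix \<alpha> :: "nat ^ 'd" assume \<alpha>: "\<alpha> \<in> UNIV - range (\<lambda>\<alpha>. \<alpha> + axis k 1)"
      have "\<alpha> $ k = 0"
      proof (rule ccontr)
        assume "\<alpha> $ k \<noteq> 0"
        then have "\<alpha> = (\<chi> i. if i = k then \<alpha> $ i - 1 else \<alpha> $ i) + axis k 1"
          by (auto simp: vec_eq_iff axis_def)
        then show False using \<alpha> by blast
      qed
      then show "a \<alpha> * mpow z \<alpha> = 0" by (simp add: a0)
    qed auto
    also have "\<dots> \<longleftrightarrow> ((\<lambda>\<alpha>. b \<alpha> * mpow z \<alpha> * z $ k) has_sum f (p + z)) UNIV"
      by (subst has_sum_reindex)
        (auto simp: inj_on_def o_def b_def mpow_def prod_power_add_axis mult.assoc simp del: vector_add_component One_nat_def)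
    finally have "((\<lambda>\<alpha>. b \<alpha> * mpow z \<alpha> * z $ k) has_sum f (p + z)) UNIV" .
    moreover have "((\<lambda>\<alpha>. b \<alpha> * mpow z \<alpha> * z $ k) has_sum h (p + z) * z $ k) UNIV"
      using z by (intro has_sum_cmult_left expansion_atD(2)[OF h]) auto
    ultimately show ?thesis using p by (simp add: has_sum_unique mult.commute)
  qed
  then have "\<forall>\<^sub>F z in nhds p. f z = z $ k * h z"
    using \<rho> unfolding eventually_nhds_polydisc by blast
  then show ?thesis using h by (auto simp: analytic_iff_expansion)
qed

lemma local_equation_coordinate:
  assumes "p $ k = 0"
  shows "local_equation {z. z $ k = 0} p (\<lambda>z. z $ k)"
  unfolding local_equation_def using assms coordinate_analytic divisible_by_coordinate by auto

text \<open>The order of vanishing is defined by means of an arbitrary local equation, but any such equation is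
  a bounded multiple of \<open>z\<^sub>k\<close>. For the lower estimate of exponents this growth bound is all that is needed,
  and it spares the multiplication of power series.\<close>

lemma vanishing_order_imp_bound:
  fixes p :: "complex ^ 'd::finite"
  assumes f: "vanishes_to_order_at {z. z $ k = 0} p n f" and p: "p $ k = 0"
  shows "\<exists>K\<ge>0. \<forall>\<^sub>F z in nhds p. norm (f z) \<le> K * norm (z $ k) ^ n"
proof -
  obtain u h where u: "local_equation {z. z $ k = 0} p u" and h: "analytic_at_pt p h"
    and fu: "\<forall>\<^sub>F z in nhds p. f z = u z ^ n * h z"
    using f by (auto simp: vanishes_to_order_at_def)
  obtain u1 where u1: "analytic_at_pt p u1" "\<forall>\<^sub>F z in nhds p. u z = z $ k * u1 z"
    using divisible_by_coordinate[OF _ p] u by (auto simp: local_equation_def)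
  obtain K1 K2 where K: "\<forall>\<^sub>F z in nhds p. norm (u1 z) \<le> K1" "\<forall>\<^sub>F z in nhds p. norm (h z) \<le> K2"
    using analytic_imp_bounded u1(1) h by metis
  have "\<forall>\<^sub>F z in nhds p. norm (f z) \<le> (\<bar>K1\<bar> ^ n * \<bar>K2\<bar>) * norm (z $ k) ^ n"
    using fu u1(2) K
  proof eventually_elim
    case (elim z)
    have "norm (f z) = norm (z $ k) ^ n * (norm (u1 z) ^ n * norm (h z))"
      using elim by (simp add: norm_mult norm_power power_mult_distrib)
    also have "\<dots> \<le> norm (z $ k) ^ n * (\<bar>K1\<bar> ^ n * \<bar>K2\<bar>)"
      using elim by (intro mult_left_mono mult_mono power_mono) auto
    finally show ?case by (simp add: mult_ac)
  qed
  then show ?thesis by (intro exI[of _ "\<bar>K1\<bar> ^ n * \<bar>K2\<bar>"]) auto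
qed

text \<open>The binomial theorem in all variables at once, as a sum over all multi-indices: binomial
  coefficients vanish beyond the exponents. Stated for normed fields in order to be used for the
  terms and for their absolute values.\<close>

lemma multinomial_has_sum:
  fixes u v :: "'d::finite \<Rightarrow> 'a::real_normed_field" and e :: "'d \<Rightarrow> nat"
  shows "((\<lambda>\<beta>::nat^'d. \<Prod>m\<in>UNIV. of_nat (e m choose \<beta> $ m) * u m ^ (\<beta> $ m) * v m ^ (e m - \<beta> $ m))
    has_sum (\<Prod>m\<in>UNIV. (u m + v m) ^ e m)) UNIV"
proof -
  define P where "P = PiE (UNIV :: 'd set) (\<lambda>m. {..e m})"
  have P: "finite P" by (simp add: P_def finite_PiE)
  have inj: "inj_on vec_lambda P" by (auto simp: inj_on_def vec_lambda_inject)
  show ?thesis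
  proof (rule has_sum_finite_neutralI[where B = "vec_lambda ` P"])
    fix \<beta> :: "nat ^ 'd" assume "\<beta> \<in> UNIV - vec_lambda ` P"
    then have "(\<lambda>m. \<beta> $ m) \<notin> P" by (metis DiffD2 image_eqI vec_lambda_eta)
    then obtain m where "\<not> \<beta> $ m \<le> e m" by (auto simp: P_def PiE_iff)
    then show "(\<Prod>m\<in>UNIV. of_nat (e m choose \<beta> $ m) * u m ^ (\<beta> $ m) * v m ^ (e m - \<beta> $ m)) = 0"
      by (intro prod_zero bexI[of _ m]) auto
  next
    have "(\<Prod>m\<in>UNIV. (u m + v m) ^ e m) =
        (\<Prod>m\<in>UNIV. \<Sum>t\<in>{..e m}. of_nat (e m choose t) * u m ^ t * v m ^ (e m - t))"
      by (simp add: binomial_ring)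
    also have "\<dots> = (\<Sum>g\<in>P. \<Prod>m\<in>UNIV. of_nat (e m choose g m) * u m ^ g m * v m ^ (e m - g m))"
      unfolding P_def by (rule prod_sum_PiE) auto
    also have "\<dots> = (\<Sum>\<beta>\<in>vec_lambda ` P. \<Prod>m\<in>UNIV. of_nat (e m choose \<beta> $ m) * u m ^ (\<beta> $ m) * v m ^ (e m - \<beta> $ m))"
      by (subst sum.reindex[OF inj]) simp
    finally show "(\<Prod>m\<in>UNIV. (u m + v m) ^ e m) = \<dots>" .
  qed (use P in auto)
qed

text \<open>A series of monomials centred at \<open>0\<close> is re-expanded at \<open>p\<close>. The hypothesis says that the double
  series arising from the binomial theorem converges absolutely for increments up to \<open>R\<close>, which justifies
  exchanging the two summations. The index type is arbitrary because different indices may carry the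
  same monomial.\<close>

lemma monomial_series_analytic:
  fixes b :: "'x \<Rightarrow> complex" and e :: "'x \<Rightarrow> 'd::finite \<Rightarrow> nat" and p :: "complex ^ 'd"
  assumes R: "R > 0"
    and summable: "(\<lambda>x. norm (b x) * (\<Prod>m\<in>UNIV. (norm (p $ m) + R) ^ e x m)) summable_on UNIV"
  shows "analytic_at_pt p (\<lambda>z. \<Sum>\<^sub>\<infinity>x. b x * (\<Prod>m\<in>UNIV. z $ m ^ e x m))"
proof -
  define C where "C = (\<lambda>\<beta>::nat^'d. \<Sum>\<^sub>\<infinity>x. b x * (\<Prod>m\<in>UNIV. of_nat (e x m choose \<beta> $ m) * p $ m ^ (e x m - \<beta> $ m)))"
  have "((\<lambda>\<beta>. C \<beta> * mpow z \<beta>) has_sum (\<Sum>\<^sub>\<infinity>x. b x * (\<Prod>m\<in>UNIV. (p + z) $ m ^ e x m))) UNIV"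
    if z: "\<forall>i. norm (z $ i) < R" for z
  proof -
    define T where "T = (\<lambda>(x, \<beta>::nat^'d). b x *
      (\<Prod>m\<in>UNIV. of_nat (e x m choose \<beta> $ m) * z $ m ^ (\<beta> $ m) * p $ m ^ (e x m - \<beta> $ m)))"
    have nT: "((\<lambda>\<beta>. norm (T (x, \<beta>))) has_sum (norm (b x) * (\<Prod>m\<in>UNIV. (norm (z $ m) + norm (p $ m)) ^ e x m))) UNIV" for x
      using has_sum_cmult_right[OF multinomial_has_sum[of "e x" "\<lambda>m. norm (z $ m)" "\<lambda>m. norm (p $ m)"], of "norm (b x)"]
      by (simp add: T_def norm_mult prod_norm[symmetric] norm_power)
    have iT: "((\<lambda>\<beta>. T (x, \<beta>)) has_sum (b x * (\<Prod>m\<in>UNIV. (p + z) $ m ^ e x m))) UNIV" for x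
      using has_sum_cmult_right[OF multinomial_has_sum[of "e x" "\<lambda>m. z $ m" "\<lambda>m. p $ m"], of "b x"]
      by (simp add: T_def add.commute)
    have "(\<lambda>x. norm (norm (b x) * (\<Prod>m\<in>UNIV. (norm (z $ m) + norm (p $ m)) ^ e x m))) summable_on UNIV"
      using summable
    proof (rule Infinite_Sum.abs_summable_on_comparison_test')
      show "norm (norm (b x) * (\<Prod>m\<in>UNIV. (norm (z $ m) + norm (p $ m)) ^ e x m))
          \<le> norm (b x) * (\<Prod>m\<in>UNIV. (norm (p $ m) + R) ^ e x m)" for x
      proof -
        have "norm (z $ m) + norm (p $ m) \<le> norm (p $ m) + R" for m
          using z[rule_format, of m] by simp
        then have "(\<Prod>m\<in>UNIV. (norm (z $ m) + norm (p $ m)) ^ e x m) \<le> (\<Prod>m\<in>UNIV. (norm (p $ m) + R) ^ e x m)"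
          by (intro prod_mono conjI power_mono) auto
        then show ?thesis by (simp add: abs_mult abs_prod mult_left_mono)
      qed
    qed
    then have "(\<lambda>x. norm (b x) * (\<Prod>m\<in>UNIV. (norm (z $ m) + norm (p $ m)) ^ e x m)) summable_on UNIV"
      by (rule abs_summable_summable)
    then have "(\<lambda>y. norm (T y)) summable_on UNIV \<times> UNIV"
      using nT by (intro summable_on_SigmaI) auto
    then have Ts: "T summable_on UNIV \<times> UNIV" by (rule abs_summable_summable)
    define S where "S = infsum T (UNIV \<times> UNIV)"
    have TS: "(T has_sum S) (UNIV \<times> UNIV)" unfolding S_def using Ts by (rule has_sum_infsum)
    have 1: "((\<lambda>x. b x * (\<Prod>m\<in>UNIV. (p + z) $ m ^ e x m)) has_sum S) UNIV"
      by (rule has_sum_SigmaD[OF TS]) (rule iT)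
    have swap: "((\<lambda>(\<beta>, x). T (x, \<beta>)) has_sum S) (UNIV \<times> UNIV)"
      using TS by (subst (asm) has_sum_swap)
    have 2: "((\<lambda>\<beta>. C \<beta> * mpow z \<beta>) has_sum S) UNIV"
    proof (rule has_sum_SigmaD[OF swap])
      fix \<beta> :: "nat ^ 'd"
      have "(\<lambda>x. T (x, \<beta>)) summable_on UNIV"
        using summable_on_SigmaD1[OF has_sum_imp_summable[OF swap], of \<beta>] by simp
      moreover have "T (x, \<beta>) = b x * (\<Prod>m\<in>UNIV. of_nat (e x m choose \<beta> $ m) * p $ m ^ (e x m - \<beta> $ m)) * mpow z \<beta>" for x
        by (simp add: T_def mpow_def prod.distrib mult_ac)
      ultimately show "((\<lambda>x. case (\<beta>, x) of (\<beta>, x) \<Rightarrow> T (x, \<beta>)) has_sum C \<beta> * mpow z \<beta>) UNIV"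
        unfolding C_def infsum_cmult_left'[symmetric] by (simp add: has_sum_infsum)
    qed
    show ?thesis using 2 infsumI[OF 1] by simp
  qed
  then have "expansion_at p (\<lambda>z. \<Sum>\<^sub>\<infinity>x. b x * (\<Prod>m\<in>UNIV. z $ m ^ e x m)) C R"
    using R by (simp add: expansion_at_def)
  then show ?thesis by (auto simp: analytic_iff_expansion)
qed

section \<open>Pullback under a monomial map\<close>

definition monomial_map :: "('d \<Rightarrow> 'd \<Rightarrow> nat) \<Rightarrow> complex ^ 'd \<Rightarrow> complex ^ 'd" where
  "monomial_map M z = (\<chi> i. \<Prod>m\<in>UNIV. z $ m ^ M i m)"

lemma prod_power_monomial:
  fixes r :: "'d::finite \<Rightarrow> 'a::comm_semiring_1"
  shows "(\<Prod>i\<in>UNIV. (\<Prod>m\<in>UNIV. r m ^ M i m) ^ (\<alpha> i)) = (\<Prod>m\<in>UNIV. r m ^ (\<Sum>i\<in>UNIV. M i m * \<alpha> i))"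
  unfolding prod_power_distrib power_mult[symmetric] power_sum by (rule prod.swap)

text \<open>The quotient of the pullback by \<open>z\<^sub>k^n\<close> is a series of monomials. It is analytic at \<open>p\<close> even if
  other coordinates of \<open>p\<close> are large: each coordinate of the monomial map contains a positive power
  of \<open>z\<^sub>k\<close>, so a neighbourhood of \<open>p\<close> is mapped into the polydisc of convergence.\<close>

lemma pullback_vanishes:
  fixes p :: "complex ^ 'd::finite"
  assumes a: "expansion_at 0 g a \<rho>" and p: "p $ k = 0" and M: "\<And>i. M i k \<ge> 1"
    and n: "\<And>\<alpha>. a \<alpha> \<noteq> 0 \<Longrightarrow> n \<le> (\<Sum>i\<in>UNIV. M i k * \<alpha> $ i)"
  shows "vanishes_to_order_at {z. z $ k = 0} p n (\<lambda>z. g (monomial_map M z))"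
proof -
  define X where "X = (\<lambda>t i. \<Prod>m\<in>UNIV. (norm (p $ m) + t) ^ M i m)"
  have "\<forall>\<^sub>F t in at_right 0. \<forall>i. X t i < \<rho>"
  proof (rule eventually_all_finite)
    fix i
    have "((\<lambda>t. X t i) \<longlongrightarrow> X 0 i) (at_right 0)"
      unfolding X_def by (intro tendsto_intros)
    moreover have "X 0 i = 0"
      unfolding X_def using p M[of i] by (intro prod_zero) (auto intro!: exI[of _ k])
    ultimately show "\<forall>\<^sub>F t in at_right 0. X t i < \<rho>"
      using expansion_atD(1)[OF a] by (simp add: order_tendstoD)
  qed
  then have "\<forall>\<^sub>F t in at_right 0. (\<forall>i. X t i < \<rho>) \<and> t > 0"
    using eventually_at_right_less by (rule eventually_conj)
  then obtain R where R: "R > 0" "\<And>i. X R i < \<rho>"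
    using eventually_happens'[OF trivial_limit_at_right_real] by blast
  have X0: "0 \<le> X R i" for i using R by (auto simp: X_def intro!: prod_nonneg)
  define e where "e = (\<lambda>\<alpha>::nat^'d. \<lambda>m. (\<Sum>i\<in>UNIV. M i m * \<alpha> $ i) - (if m = k then n else 0))"
  have split: "(\<Prod>i\<in>UNIV. (\<Prod>m\<in>UNIV. r m ^ M i m) ^ (\<alpha> $ i)) = r k ^ n * (\<Prod>m\<in>UNIV. r m ^ e \<alpha> m)"
    if "a \<alpha> \<noteq> 0" for \<alpha> and r :: "'d \<Rightarrow> 'c::comm_semiring_1"
  proof -
    have "(\<Prod>m\<in>UNIV. r m ^ (\<Sum>i\<in>UNIV. M i m * \<alpha> $ i)) = (\<Prod>m\<in>UNIV. (if m = k then r m ^ n else 1) * r m ^ e \<alpha> m)"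
      by (rule prod.cong) (use n[OF that] in \<open>auto simp: e_def power_add[symmetric]\<close>)
    then show ?thesis by (simp add: prod_power_monomial prod.distrib)
  qed
  define h where "h = (\<lambda>z::complex^'d. \<Sum>\<^sub>\<infinity>\<alpha>. a \<alpha> * (\<Prod>m\<in>UNIV. z $ m ^ e \<alpha> m))"
  have "(\<lambda>\<alpha>. norm (a \<alpha>) * (\<Prod>i\<in>UNIV. X R i ^ (\<alpha> $ i))) summable_on UNIV"
    using X0 R(2) by (rule expansion_at_abs_summable[OF a])
  moreover have "norm (a \<alpha>) * (\<Prod>i\<in>UNIV. X R i ^ (\<alpha> $ i)) =
      R ^ n * (norm (a \<alpha>) * (\<Prod>m\<in>UNIV. (norm (p $ m) + R) ^ e \<alpha> m))" for \<alpha>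
    using split[of \<alpha> "\<lambda>m. norm (p $ m) + R"] p by (cases "a \<alpha> = 0") (auto simp: X_def mult_ac)
  ultimately have "(\<lambda>\<alpha>. R ^ n * (norm (a \<alpha>) * (\<Prod>m\<in>UNIV. (norm (p $ m) + R) ^ e \<alpha> m))) summable_on UNIV"
    by (simp only:)
  then have "(\<lambda>\<alpha>. inverse (R ^ n) * (R ^ n * (norm (a \<alpha>) * (\<Prod>m\<in>UNIV. (norm (p $ m) + R) ^ e \<alpha> m)))) summable_on UNIV"
    by (rule summable_on_cmult_right)
  then have "(\<lambda>\<alpha>. norm (a \<alpha>) * (\<Prod>m\<in>UNIV. (norm (p $ m) + R) ^ e \<alpha> m)) summable_on UNIV"
    using R(1) by (simp add: mult.assoc[symmetric])
  then have h: "analytic_at_pt p h"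
    unfolding h_def using R(1) by (intro monomial_series_analytic)
  have "g (monomial_map M (p + z)) = (p + z) $ k ^ n * h (p + z)" if z: "\<forall>i. norm (z $ i) < R" for z
  proof -
    have "norm (monomial_map M (p + z) $ i) \<le> X R i" for i
    proof -
      have "norm (p $ m + z $ m) \<le> norm (p $ m) + R" for m
        using z[rule_format, of m] norm_triangle_ineq[of "p $ m" "z $ m"] by simp
      then show ?thesis
        unfolding monomial_map_def X_def
        by (simp add: prod_norm[symmetric] norm_power) (intro prod_mono conjI power_mono, auto)
    qed
    then have "((\<lambda>\<alpha>. a \<alpha> * mpow (monomial_map M (p + z)) \<alpha>) has_sum g (0 + monomial_map M (p + z))) UNIV"
      using R(2) by (intro expansion_atD(2)[OF a]) (metis le_less_trans)
    moreover have "a \<alpha> * mpow (monomial_map M (p + z)) \<alpha> =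
        (p + z) $ k ^ n * (a \<alpha> * (\<Prod>m\<in>UNIV. (p + z) $ m ^ e \<alpha> m))" for \<alpha>
      using split[of \<alpha> "\<lambda>m. (p + z) $ m"]
      by (cases "a \<alpha> = 0") (auto simp: mpow_def monomial_map_def mult_ac)
    ultimately have "((\<lambda>\<alpha>. (p + z) $ k ^ n * (a \<alpha> * (\<Prod>m\<in>UNIV. (p + z) $ m ^ e \<alpha> m))) has_sum
        g (monomial_map M (p + z))) UNIV"
      by (simp only: add_0)
    from infsumI[OF this] show ?thesis by (simp only: h_def infsum_cmult_right')
  qed
  then have "\<forall>\<^sub>F z in nhds p. g (monomial_map M z) = z $ k ^ n * h z"
    using R(1) unfolding eventually_nhds_polydisc by blast
  then show ?thesis
    unfolding vanishes_to_order_at_def using h local_equation_coordinate[OF p] by blast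
qed

text \<open>On the polycircle with radius \<open>s\<close> in the variable \<open>k\<close> and a fixed radius in the others, the bound
  \<open>O(s^n)\<close> holds; since the monomial map sends this polycircle onto one around \<open>0\<close>, the Cauchy estimate
  applies there and reads \<open>\<bar>a\<^sub>\<alpha>\<bar> c s^E \<le> K s^n\<close> with \<open>E\<close> the exponent of \<open>z\<^sub>k\<close> in the pulled back
  monomial. Letting \<open>s\<close> tend to \<open>0\<close> excludes \<open>E < n\<close>.\<close>

lemma pullback_vanishes_only_if:
  fixes a :: "nat ^ 'd::finite \<Rightarrow> complex"
  assumes a: "expansion_at 0 g a \<rho>" and M: "\<And>i. M i k \<ge> 1"
    and surj: "\<And>\<zeta>. (\<And>i. norm (\<zeta> i) = 1) \<Longrightarrow>
      \<exists>\<eta>. (\<forall>m. norm (\<eta> m) = 1) \<and> (\<forall>i. (\<Prod>m\<in>UNIV. \<eta> m ^ M i m) = (\<zeta> i :: complex))"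
    and van: "vanishes_to_order_at {z. z $ k = 0} 0 n (\<lambda>z. g (monomial_map M z))"
    and \<alpha>: "a \<alpha> \<noteq> 0"
  shows "n \<le> (\<Sum>i\<in>UNIV. M i k * \<alpha> $ i)"
proof (rule ccontr)
  define E where "E = (\<lambda>m. \<Sum>i\<in>UNIV. M i m * \<alpha> $ i)"
  assume "\<not> n \<le> (\<Sum>i\<in>UNIV. M i k * \<alpha> $ i)"
  then have n: "Suc (E k) \<le> n" by (simp add: E_def)
  obtain K where K0: "K \<ge> 0" and "\<forall>\<^sub>F z in nhds 0. norm (g (monomial_map M z)) \<le> K * norm (z $ k) ^ n"
    using vanishing_order_imp_bound[OF van] by auto
  then obtain \<epsilon> where \<epsilon>: "\<epsilon> > 0"
      and K: "\<And>z. \<forall>i. norm (z $ i) < \<epsilon> \<Longrightarrow> norm (g (monomial_map M z)) \<le> K * norm (z $ k) ^ n"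
    unfolding eventually_nhds_polydisc by (auto simp: add_0)
  define q where "q = min \<epsilon> 1 / 2"
  have q: "0 < q" "q < \<epsilon>" "q \<le> 1" using \<epsilon> by (auto simp: q_def)
  define c where "c = (\<Prod>m\<in>UNIV. (if m = k then 1 else q) ^ E m)"
  have c: "c > 0" unfolding c_def using q by (intro prod_pos) auto
  have bound: "norm (a \<alpha>) * c \<le> K * s" if s: "0 < s" "s < q" "s < \<rho>" for s
  proof -
    define r where "r = (\<lambda>m. if m = k then s else q)"
    have r: "0 < r m" "r m < \<epsilon>" "r m \<le> 1" for m using s q by (auto simp: r_def)
    define X where "X = (\<lambda>i. \<Prod>m\<in>UNIV. r m ^ M i m)"
    have X0: "0 < X i" for i unfolding X_def using r by (intro prod_pos) auto
    have X1: "X i < \<rho>" for i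
    proof -
      have "X i = r k ^ M i k * (\<Prod>m\<in>UNIV - {k}. r m ^ M i m)"
        unfolding X_def by (rule prod.remove) auto
      also have "\<dots> \<le> r k ^ 1 * 1"
      proof (rule mult_mono)
        show "r k ^ M i k \<le> r k ^ 1" using r[of k] M[of i] by (intro power_decreasing) auto
        show "(\<Prod>m\<in>UNIV - {k}. r m ^ M i m) \<le> 1"
          using r by (intro prod_le_1) (auto intro!: power_le_one simp: less_imp_le)
        show "0 \<le> (\<Prod>m\<in>UNIV - {k}. r m ^ M i m)"
          using r by (intro prod_nonneg) (auto simp: less_imp_le)
      qed (use r[of k] in auto)
      finally show ?thesis using s by (simp add: r_def)
    qed
    have "norm (a \<alpha>) * (\<Prod>i\<in>UNIV. X i ^ (\<alpha> $ i)) \<le> K * s ^ n"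
    proof (rule cauchy_estimate[where F = g])
      fix z :: "complex ^ 'd" assume z: "\<forall>i. norm (z $ i) = X i"
      show "((\<lambda>\<alpha>. a \<alpha> * mpow z \<alpha>) has_sum g z) UNIV"
        using expansion_atD(2)[OF a, of z] z X1 by simp
      have "norm (z $ i / of_real (X i)) = 1" for i using z X0[of i] by (simp add: norm_divide)
      from surj[of "\<lambda>i. z $ i / of_real (X i)", OF this] obtain \<eta> where
        \<eta>: "\<And>m. norm (\<eta> m) = 1" "\<And>i. (\<Prod>m\<in>UNIV. \<eta> m ^ M i m) = z $ i / of_real (X i)" by blast
      define w :: "complex ^ 'd" where "w = (\<chi> m. of_real (r m) * \<eta> m)"
      have "monomial_map M w $ i = z $ i" for i
      proof -
        have "monomial_map M w $ i = of_real (X i) * (\<Prod>m\<in>UNIV. \<eta> m ^ M i m)"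
          by (simp add: monomial_map_def w_def power_mult_distrib prod.distrib X_def)
        then show ?thesis using X0[of i] by (simp add: \<eta>(2))
      qed
      then have "monomial_map M w = z" by (simp add: vec_eq_iff)
      have nw: "norm (w $ m) = r m" for m using \<eta>(1)[of m] r(1)[of m] by (simp add: w_def norm_mult)
      show "norm (g z) \<le> K * s ^ n"
      proof -
        have "norm (w $ k) = s" by (simp add: nw r_def)
        then show ?thesis using K[of w] r(2) \<open>monomial_map M w = z\<close> by (simp add: nw)
      qed
    qed (use X0 in \<open>simp add: less_imp_le\<close>)
    also have "(\<Prod>i\<in>UNIV. X i ^ (\<alpha> $ i)) = (\<Prod>m\<in>UNIV. r m ^ E m)"
      unfolding X_def E_def by (rule prod_power_monomial)
    also have "\<dots> = (\<Prod>m\<in>UNIV. (if m = k then s ^ E m else 1) * (if m = k then 1 else q) ^ E m)"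
      by (rule prod.cong) (auto simp: r_def)
    also have "\<dots> = s ^ E k * c" by (simp add: prod.distrib c_def)
    also have "K * s ^ n \<le> K * s ^ Suc (E k)"
      using K0 s q n by (intro mult_left_mono power_decreasing) auto
    finally have "s ^ E k * (norm (a \<alpha>) * c) \<le> s ^ E k * (K * s)" by (simp add: mult_ac)
    then show ?thesis using s(1) by simp
  qed
  define t where "t = norm (a \<alpha>) * c"
  have t: "t > 0" using \<alpha> c by (simp add: t_def)
  define s where "s = min (min q \<rho>) (t / (K + 1)) / 2"
  have s: "0 < s" "s < q" "s < \<rho>" using q t K0 expansion_atD(1)[OF a] by (auto simp: s_def)
  have "s \<le> t / (K + 1) / 2" unfolding s_def by (rule divide_right_mono) auto
  then have "(K + 1) * s \<le> t / 2" using K0 by (simp add: field_simps)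
  then have "K * s < t" using t s by (simp add: algebra_simps)
  then show False using bound[OF s] by (simp add: t_def)
qed

section \<open>The charts of the iterated blow-ups\<close>

text \<open>The part of unimodularity of the exponent matrix that the Cauchy estimate needs: the monomial map of
  compact tori is onto. Unlike a determinant, it passes to blow-ups by an explicit formula.\<close>

definition unitary_surjective :: "('d \<Rightarrow> 'd \<Rightarrow> nat) \<Rightarrow> bool" where
  "unitary_surjective M \<longleftrightarrow> (\<forall>\<zeta>. (\<forall>i. norm (\<zeta> i) = 1) \<longrightarrow>
     (\<exists>\<eta>. (\<forall>m. norm (\<eta> m) = 1) \<and> (\<forall>i. (\<Prod>m\<in>UNIV. \<eta> m ^ M i m) = (\<zeta> i :: complex))))"

text \<open>The invariants of a chart after the points \<open>P\<close> have been blown up. The second and third clauses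
  say that blown-up points have disappeared and that every exceptional point arises from one of them;
  together they keep old and new exceptional points apart. The surjectivity of the characters makes each
  of them nontrivial, hence the origin the only possible fixed point. The last clause describes the
  points of the \<open>n\<close>-th divisor that have not been blown up: they form a coordinate hyperplane without
  some other hyperplanes \<open>z\<^sub>m = 0\<close>, \<open>m \<in> S\<close>, namely those of later divisors. The exponents \<open>w n\<close> are
  shared by all charts.\<close>

definition monomial_chart ::
  "(complex ^ 'd::finite) bl_point list \<Rightarrow> (nat \<Rightarrow> 'd \<Rightarrow> nat) \<Rightarrow> 'd chart \<Rightarrow> ('d \<Rightarrow> 'd \<Rightarrow> nat) \<Rightarrow> bool" where
  "monomial_chart P w c M \<longleftrightarrow>
     inj (fst c) \<and>
     (\<forall>z. fst c z \<notin> set P) \<and>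
     (\<forall>z q l. fst c z = Exc q l \<longrightarrow> q \<in> set P) \<and>
     (\<forall>u\<in>torus. \<exists>t\<in>torus. snd c t = u) \<and>
     (\<forall>z. blow_down (fst c z) = monomial_map M z) \<and>
     unitary_surjective M \<and>
     (\<forall>n<length P. {z. \<exists>l. fst c z = Exc (P ! n) l} = {} \<or>
        (\<exists>k S. k \<notin> S \<and> {z. \<exists>l. fst c z = Exc (P ! n) l} = {z. z $ k = 0 \<and> (\<forall>m\<in>S. z $ m \<noteq> 0)} \<and>
               (\<forall>i. M i k = w n i)))"

lemma monomial_chartD:
  assumes "monomial_chart P w c M"
  shows "fst c x = fst c y \<Longrightarrow> x = y" and "fst c z \<notin> set P" and "fst c z = Exc q l \<Longrightarrow> q \<in> set P"
    and "u \<in> torus \<Longrightarrow> \<exists>t\<in>torus. snd c t = u"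
    and "blow_down (fst c z) = monomial_map M z" and "unitary_surjective M"
    and "n < length P \<Longrightarrow> {z. \<exists>l. fst c z = Exc (P ! n) l} = {} \<or>
        (\<exists>k S. k \<notin> S \<and> {z. \<exists>l. fst c z = Exc (P ! n) l} = {z. z $ k = 0 \<and> (\<forall>m\<in>S. z $ m \<noteq> 0)} \<and>
               (\<forall>i. M i k = w n i))"
proof -
  note c = assms[unfolded monomial_chart_def]
  have "inj (fst c)" using c by (rule conjunct1)
  then show "fst c x = fst c y \<Longrightarrow> x = y" by (rule injD)
  show "fst c z \<notin> set P" using c by simp
  show "fst c z = Exc q l \<Longrightarrow> q \<in> set P" using c by metis
  show "u \<in> torus \<Longrightarrow> \<exists>t\<in>torus. snd c t = u" using c by simp
  show "blow_down (fst c z) = monomial_map M z" "unitary_surjective M" using c by simp_all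
  show "n < length P \<Longrightarrow> {z. \<exists>l. fst c z = Exc (P ! n) l} = {} \<or>
        (\<exists>k S. k \<notin> S \<and> {z. \<exists>l. fst c z = Exc (P ! n) l} = {z. z $ k = 0 \<and> (\<forall>m\<in>S. z $ m \<noteq> 0)} \<and>
               (\<forall>i. M i k = w n i))"
    using c by (elim conjE) (drule spec, erule (1) mp)
qed

text \<open>Uniqueness of the chart with a given origin is what makes the exponents of a new divisor well
  defined. The existence of a chart meeting each divisor keeps the valuations finite.\<close>

definition toric_atlas ::
  "(complex ^ 'd::finite) bl_point list \<Rightarrow> (nat \<Rightarrow> 'd \<Rightarrow> nat) \<Rightarrow> 'd chart set \<Rightarrow> bool" where
  "toric_atlas P w A \<longleftrightarrow>
     (\<forall>c\<in>A. \<exists>M. monomial_chart P w c M) \<and>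
     (\<forall>c\<in>A. \<forall>c'\<in>A. fst c 0 = fst c' 0 \<longrightarrow> c = c') \<and>
     (\<forall>n<length P. (\<exists>c\<in>A. \<exists>z l. fst c z = Exc (P ! n) l) \<and> (\<forall>i. w n i \<ge> 1)) \<and>
     (\<forall>q l. Exc q l \<in> set P \<longrightarrow> q \<in> set P) \<and>
     (\<forall>q\<in>set P. blow_down q = 0)"

text \<open>Under \<open>y\<^sub>k = z\<^sub>k\<close>, \<open>y\<^sub>m = z\<^sub>k z\<^sub>m\<close> the exponent of \<open>z\<^sub>k\<close> becomes the sum of all exponents, while the others
  persist.\<close>

lemma prod_power_blowup:
  fixes r :: "'d::finite \<Rightarrow> 'a::comm_semiring_1"
  shows "(\<Prod>m\<in>UNIV. (if m = k then r k else r k * r m) ^ N m) =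
    (\<Prod>m\<in>UNIV. r m ^ (if m = k then \<Sum>m\<in>UNIV. N m else N m))"
proof -
  have "(\<Prod>m\<in>UNIV. (if m = k then r k else r k * r m) ^ N m) =
      (\<Prod>m\<in>UNIV. r k ^ N m * (if m = k then 1 else r m ^ N m))"
    by (rule prod.cong) (auto simp: power_mult_distrib)
  also have "\<dots> = r k ^ (\<Sum>m\<in>UNIV. N m) * (\<Prod>m\<in>UNIV. if m = k then 1 else r m ^ N m)"
    by (simp add: prod.distrib power_sum)
  also have "\<dots> = (\<Prod>m\<in>UNIV. (if m = k then r m ^ (\<Sum>m\<in>UNIV. N m) else 1) * (if m = k then 1 else r m ^ N m))"
    by (simp add: prod.distrib)
  also have "\<dots> = (\<Prod>m\<in>UNIV. r m ^ (if m = k then \<Sum>m\<in>UNIV. N m else N m))"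
    by (rule prod.cong) auto
  finally show ?thesis .
qed

definition blowup_matrix :: "'d \<Rightarrow> ('d \<Rightarrow> 'd::finite \<Rightarrow> nat) \<Rightarrow> 'd \<Rightarrow> 'd \<Rightarrow> nat" where
  "blowup_matrix k M = (\<lambda>i m. if m = k then \<Sum>m\<in>UNIV. M i m else M i m)"

lemma unitary_surjective_blowup:
  assumes "unitary_surjective M"
  shows "unitary_surjective (blowup_matrix k M)"
  unfolding unitary_surjective_def
proof (intro allI impI)
  fix \<zeta> :: "'a \<Rightarrow> complex" assume "\<forall>i. norm (\<zeta> i) = 1"
  then obtain \<eta> where \<eta>: "\<And>m. norm (\<eta> m) = 1" "\<And>i. (\<Prod>m\<in>UNIV. \<eta> m ^ M i m) = \<zeta> i"
    using assms unfolding unitary_surjective_def by metis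
  define \<eta>' where "\<eta>' = (\<lambda>m. if m = k then \<eta> k else \<eta> m / \<eta> k)"
  have k: "\<eta> k \<noteq> 0" using \<eta>(1)[of k] by auto
  have e: "(if m = k then \<eta>' k else \<eta>' k * \<eta>' m) = \<eta> m" for m using k by (simp add: \<eta>'_def)
  have "(\<Prod>m\<in>UNIV. \<eta>' m ^ blowup_matrix k M i m) = \<zeta> i" for i
    using prod_power_blowup[of k \<eta>' "M i"] unfolding e by (simp add: blowup_matrix_def \<eta>)
  moreover have "norm (\<eta>' m) = 1" for m by (simp add: \<eta>'_def norm_divide \<eta>)
  ultimately show "\<exists>\<eta>. (\<forall>m. norm (\<eta> m) = 1) \<and> (\<forall>i. (\<Prod>m\<in>UNIV. \<eta> m ^ blowup_matrix k M i m) = \<zeta> i)"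
    by blast
qed

lemma cline_eqD:
  assumes "cline a = cline b" "a $ k = 1" "b $ k = 1"
  shows "a = b"
proof -
  have "a \<in> cline a" unfolding cline_def by (rule image_eqI[of _ _ 1]) auto
  then obtain c where c: "a = c *s b" using assms(1) by (auto simp: cline_def)
  then have "c = 1" using assms(2,3) by simp
  then show ?thesis using c by simp
qed

definition blowup_coords :: "'d \<Rightarrow> complex ^ 'd \<Rightarrow> complex ^ 'd" where
  "blowup_coords k z = (\<chi> i. if i = k then z $ k else z $ k * z $ i)"

lemma blowup_coords_nth: "blowup_coords k z $ i = (if i = k then z $ k else z $ k * z $ i)"
  by (simp add: blowup_coords_def)

lemma blowup_coords_eq_0: "blowup_coords k z = 0 \<longleftrightarrow> z $ k = 0"
  by (auto simp: vec_eq_iff blowup_coords_nth)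

lemma blowup_coords_inj:
  assumes "blowup_coords k z = blowup_coords k w" "z $ k \<noteq> 0"
  shows "z = w"
proof -
  have *: "blowup_coords k z $ i = blowup_coords k w $ i" for i using assms(1) by simp
  have "z $ k = w $ k" using *[of k] by (simp add: blowup_coords_nth)
  then have "z $ i = w $ i" for i using *[of i] assms(2) by (cases "i = k") (auto simp: blowup_coords_nth)
  then show ?thesis by (simp add: vec_eq_iff)
qed

lemma monomial_map_blowup: "monomial_map M (blowup_coords k z) = monomial_map (blowup_matrix k M) z"
  unfolding monomial_map_def blowup_coords_nth blowup_matrix_def
  by (subst prod_power_blowup) simp

lemma fst_blowup_chart:
  "fst (blowup_chart k c) z = (if z $ k \<noteq> 0 then fst c (blowup_coords k z)
     else Exc (fst c 0) (cline (\<chi> i. if i = k then 1 else z $ i)))"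
  by (cases c) (simp add: blowup_chart_def blowup_coords_def)

text \<open>If \<open>z\<^sub>k \<noteq> 0\<close> the new chart is the old one in the coordinates \<open>blowup_coords k z\<close>; if \<open>z\<^sub>k = 0\<close> it meets
  the new divisor. Since \<open>blowup_coords k z = 0\<close> in the second case, the formula for the projection is the same
  in both. An old divisor \<open>z\<^sub>j = 0\<close> is missed if \<open>j = k\<close>, and otherwise gains \<open>k\<close> in its set \<open>S\<close>.\<close>

lemma monomial_chart_blowup:
  fixes c :: "'d::finite chart"
  assumes c: "monomial_chart P w c M"
    and P: "\<forall>q l. Exc q l \<in> set P \<longrightarrow> q \<in> set P"
  shows "monomial_chart (P @ [fst c 0]) (w(length P := \<lambda>i. \<Sum>m\<in>UNIV. M i m)) (blowup_chart k c) (blowup_matrix k M)"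
proof -
  let ?\<phi> = "fst c" and ?\<psi> = "fst (blowup_chart k c)" and ?q = "fst c 0"
  note inj = monomial_chartD(1)[OF c] and nP = monomial_chartD(2)[OF c] and ex = monomial_chartD(3)[OF c]
  have nq: "?\<phi> z \<noteq> Exc ?q l" for z l
  proof
    assume "?\<phi> z = Exc ?q l"
    from ex[OF this] show False using nP[of 0] by simp
  qed
  have "inj ?\<psi>"
  proof (rule injI)
    fix z w assume e: "?\<psi> z = ?\<psi> w"
    consider "z $ k \<noteq> 0" "w $ k \<noteq> 0" | "z $ k = 0" "w $ k = 0" | "(z $ k = 0) \<noteq> (w $ k = 0)" by blast
    then show "z = w"
    proof cases
      case 1
      then have "?\<phi> (blowup_coords k z) = ?\<phi> (blowup_coords k w)" using e by (simp add: fst_blowup_chart)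
      from inj[OF this] 1(1) show ?thesis by (rule blowup_coords_inj)
    next
      case 2
      then have "cline (\<chi> i. if i = k then 1 else z $ i) = cline (\<chi> i. if i = k then 1 else w $ i)"
        using e by (simp add: fst_blowup_chart)
      from cline_eqD[OF this, of k]
      have eq: "(\<chi> i. if i = k then 1 else z $ i) = (\<chi> i. if i = k then 1 else w $ i)" by simp
      have "z $ i = w $ i" for i
        using arg_cong[OF eq, of "\<lambda>v. v $ i"] 2 by (cases "i = k") auto
      then show ?thesis by (simp add: vec_eq_iff)
    next
      case 3
      then show ?thesis
        using e nq[of "blowup_coords k z"] nq[of "blowup_coords k w"]
        by (cases "z $ k = 0") (simp_all add: fst_blowup_chart, metis)
    qed
  qed
  moreover have "?\<psi> z \<notin> set (P @ [?q])" for z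
  proof (cases "z $ k = 0")
    case True
    have "Exc ?q l \<noteq> ?q" for l using nq[of 0 l] by metis
    moreover have "Exc ?q l \<notin> set P" for l using P nP[of 0] by blast
    ultimately show ?thesis using True by (simp add: fst_blowup_chart)
  next
    case False
    then have "?\<phi> (blowup_coords k z) \<noteq> ?q" using inj[of _ 0] blowup_coords_eq_0[of k z] by blast
    then show ?thesis using False nP by (simp add: fst_blowup_chart)
  qed
  moreover have "q \<in> set (P @ [?q])" if "?\<psi> z = Exc q l" for z q l
    using that ex by (auto simp: fst_blowup_chart split: if_splits)
  moreover have "\<exists>t\<in>torus. snd (blowup_chart k c) t = u" if u: "u \<in> torus" for u
  proof -
    have "blowup_coords k u \<in> torus" using u by (auto simp: torus_def blowup_coords_nth)
    then obtain t where t: "t \<in> torus" "snd c t = blowup_coords k u"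
      using monomial_chartD(4)[OF c] by blast
    have "snd (blowup_chart k c) t = u"
      using t u by (cases c) (auto simp: blowup_chart_def vec_eq_iff blowup_coords_nth torus_def)
    then show ?thesis using t by blast
  qed
  moreover have "blow_down (?\<psi> z) = monomial_map (blowup_matrix k M) z" for z
  proof -
    have "blow_down (?\<psi> z) = monomial_map M (blowup_coords k z)"
    proof (cases "z $ k = 0")
      case True
      then have "blowup_coords k z = 0" by (simp add: blowup_coords_eq_0)
      then show ?thesis using True monomial_chartD(5)[OF c, of 0] by (simp add: fst_blowup_chart)
    qed (simp add: fst_blowup_chart monomial_chartD(5)[OF c])
    then show ?thesis by (simp add: monomial_map_blowup)
  qed
  moreover have "unitary_surjective (blowup_matrix k M)"
    using monomial_chartD(6)[OF c] by (rule unitary_surjective_blowup)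
  moreover have "{z. \<exists>l. ?\<psi> z = Exc ((P @ [?q]) ! n) l} = {} \<or>
        (\<exists>j S. j \<notin> S \<and> {z. \<exists>l. ?\<psi> z = Exc ((P @ [?q]) ! n) l} = {z. z $ j = 0 \<and> (\<forall>m\<in>S. z $ m \<noteq> 0)} \<and>
               (\<forall>i. blowup_matrix k M i j = (w(length P := \<lambda>i. \<Sum>m\<in>UNIV. M i m)) n i))"
    if n: "n < length (P @ [?q])" for n
  proof (cases "n = length P")
    case True
    have "{z. \<exists>l. ?\<psi> z = Exc ((P @ [?q]) ! n) l} = {z. z $ k = 0 \<and> (\<forall>m\<in>{}. z $ m \<noteq> 0)}"
      using True nq by (auto simp: fst_blowup_chart)
    then show ?thesis using True by (intro disjI2 exI[of _ k] exI[of _ "{}"]) (auto simp: blowup_matrix_def)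
  next
    case False
    then have n: "n < length P" using n by simp
    then have Pn: "P ! n \<noteq> ?q" using nP by (metis nth_mem)
    have D: "{z. \<exists>l. ?\<psi> z = Exc ((P @ [?q]) ! n) l} =
        {z. z $ k \<noteq> 0 \<and> blowup_coords k z \<in> {y. \<exists>l. ?\<phi> y = Exc (P ! n) l}}"
      using n Pn by (auto simp: fst_blowup_chart nth_append)
    consider "{y. \<exists>l. ?\<phi> y = Exc (P ! n) l} = {}" |
      j S where "j \<notin> S" "{y. \<exists>l. ?\<phi> y = Exc (P ! n) l} = {z. z $ j = 0 \<and> (\<forall>m\<in>S. z $ m \<noteq> 0)}" "\<forall>i. M i j = w n i"
      using monomial_chartD(7)[OF c n] by blast
    then show ?thesis
    proof cases
      case 1
      then show ?thesis unfolding D by auto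
    next
      case 2
      show ?thesis
      proof (cases "j = k")
        case True
        then show ?thesis unfolding D 2(2) by (auto simp: blowup_coords_nth)
      next
        case False
        have "{z. z $ k \<noteq> 0 \<and> blowup_coords k z \<in> {y. \<exists>l. ?\<phi> y = Exc (P ! n) l}} =
            {z. z $ j = 0 \<and> (\<forall>m\<in>insert k S. z $ m \<noteq> 0)}"
          unfolding 2(2) using False by (auto simp: blowup_coords_nth)
        then show ?thesis
          unfolding D using False 2 n
          by (intro disjI2 exI[of _ j] exI[of _ "insert k S"]) (auto simp: blowup_matrix_def)
      qed
    qed
  qed
  ultimately show ?thesis unfolding monomial_chart_def by blast
qed

lemma monomial_chart_keep:
  assumes c: "monomial_chart P w c M" and q: "q \<notin> range (fst c)" "q \<notin> set P"
  shows "monomial_chart (P @ [q]) (w(length P := v)) c M"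
proof -
  have "{z. \<exists>l. fst c z = Exc ((P @ [q]) ! n) l} = {} \<or>
        (\<exists>k S. k \<notin> S \<and> {z. \<exists>l. fst c z = Exc ((P @ [q]) ! n) l} = {z. z $ k = 0 \<and> (\<forall>m\<in>S. z $ m \<noteq> 0)} \<and>
               (\<forall>i. M i k = (w(length P := v)) n i))" if "n < length (P @ [q])" for n
  proof (cases "n = length P")
    case True
    have "fst c z \<noteq> Exc q l" for z l using monomial_chartD(3)[OF c] q(2) by blast
    then show ?thesis using True by simp
  next
    case False
    then have "n < length P" using that by simp
    then show ?thesis using monomial_chartD(7)[OF c, of n] False by (simp add: nth_append)
  qed
  moreover have "fst c z \<notin> set (P @ [q])" for z using monomial_chartD(2)[OF c] q(1) by auto
  moreover have "q' \<in> set (P @ [q])" if "fst c z = Exc q' l" for z q' l using monomial_chartD(3)[OF c that] by simp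
  moreover have "inj (fst c)" using monomial_chartD(1)[OF c] by (rule injI)
  ultimately show ?thesis using monomial_chartD(4-6)[OF c] unfolding monomial_chart_def by blast
qed

text \<open>A torus element acting by \<open>2\<close> on all coordinates fixes only the origin.\<close>

lemma fixed_point_origin:
  assumes c: "c \<in> A" "monomial_chart P w c M" and orbit: "torus_orbit A q = {q}" and z: "fst c z = q"
  shows "z = 0"
proof (rule ccontr)
  assume "z \<noteq> 0"
  then obtain i where i: "z $ i \<noteq> 0" by (auto simp: vec_eq_iff)
  have "(\<chi> i. 2) \<in> torus" by (simp add: torus_def)
  then obtain t where t: "t \<in> torus" "snd c t = (\<chi> i. 2)" using monomial_chartD(4)[OF c(2)] by blast
  have "fst c (\<chi> i. snd c t $ i * z $ i) \<in> torus_orbit A q"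
    unfolding torus_orbit_def using c(1) z t(1)
    by (intro CollectI exI[of _ "fst c"] exI[of _ "snd c"] exI[of _ z] exI[of _ t] conjI) auto
  then have "fst c (\<chi> i. snd c t $ i * z $ i) = fst c z" using orbit z by simp
  then have "(\<chi> i. snd c t $ i * z $ i) = z" by (rule monomial_chartD(1)[OF c(2)])
  then have "2 * z $ i = z $ i" unfolding t(2) vec_eq_iff by simp
  then show False using i by simp
qed

text \<open>The chart centred at \<open>q\<close> is replaced by its \<open>d\<close> blow-up charts, and all other charts avoid \<open>q\<close>. A
  divisor \<open>z\<^sub>k = 0\<close> of the replaced chart is still visible in the \<open>k'\<close>-th new chart for any \<open>k' \<noteq> k\<close>;
  this is where \<open>d \<ge> 2\<close> enters. The new exponents are positive since otherwise the image of the origin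
  of the chart would have a nonzero coordinate.\<close>

lemma toric_atlas_blowup:
  fixes A :: "'d::finite chart set"
  assumes A: "toric_atlas P w A" and d: "CARD('d) \<ge> 2"
    and q: "q \<in> space_points A" "torus_orbit A q = {q}" "blow_down q = 0"
  shows "\<exists>w'. toric_atlas (P @ [q]) w' (blowup q A)"
proof -
  note A' = A[unfolded toric_atlas_def]
  have origin: "z = 0" if "c \<in> A" "fst c z = q" for c z
    using fixed_point_origin[OF that(1) _ q(2) that(2)] that(1) A' by blast
  obtain c0 z0 where c0: "c0 \<in> A" "fst c0 z0 = q" using q(1) by (auto simp: space_points_def)
  then have c00: "fst c0 0 = q" using origin by blast
  have uniq: "c = c0" if "c \<in> A" "fst c 0 = q" for c using A' that c0 c00 by metis
  obtain M where M: "monomial_chart P w c0 M" using A' c0(1) by blast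
  then have qP: "q \<notin> set P" using c00 by (auto simp: monomial_chart_def)
  have A1: "blowup q A = {c \<in> A. q \<notin> range (fst c)} \<union> {blowup_chart k c0 | k. True}"
    unfolding blowup_def using c0(1) c00 uniq by blast
  define w' where "w' = w(length P := \<lambda>i. \<Sum>m\<in>UNIV. M i m)"
  have g0: "monomial_chart (P @ [q]) w' (blowup_chart k c0) (blowup_matrix k M)" for k
    using monomial_chart_blowup[OF M, of k] A' c00 by (simp add: w'_def)
  have gk: "\<exists>M. monomial_chart (P @ [q]) w' c M" if "c \<in> A" "q \<notin> range (fst c)" for c
    using that A' monomial_chart_keep[OF _ _ qP] unfolding w'_def by blast
  have exc: "q' \<in> set P" if "c \<in> A" "fst c z = Exc q' l" for c z q' l
    using A' that monomial_chartD(3) by blast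
  have ob: "fst (blowup_chart k c0) 0 = Exc q (cline (axis k 1))" for k
  proof -
    have "(\<chi> i. if i = k then 1 else (0 :: complex ^ 'd) $ i) = axis k 1" by (simp add: vec_eq_iff axis_def)
    then show ?thesis by (simp add: fst_blowup_chart c00)
  qed
  have "\<exists>M. monomial_chart (P @ [q]) w' c M" if "c \<in> blowup q A" for c
    using that g0 gk unfolding A1 by blast
  moreover have "c = c'" if "c \<in> blowup q A" "c' \<in> blowup q A" "fst c 0 = fst c' 0" for c c'
  proof -
    have no: "fst c1 0 \<noteq> fst (blowup_chart k c0) 0" if "c1 \<in> A" for c1 k
      using exc[OF that] qP unfolding ob by blast
    have "k = k'" if "fst (blowup_chart k c0) 0 = fst (blowup_chart k' c0) 0" for k k'
    proof -
      have eq: "cline (axis k 1 :: complex ^ 'd) = cline (axis k' 1)" using that unfolding ob by simp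
      have "(axis k 1 :: complex ^ 'd) \<in> cline (axis k 1)"
        unfolding cline_def by (rule image_eqI[of _ _ 1]) auto
      then obtain x where x: "(axis k 1 :: complex ^ 'd) = x *s axis k' 1"
        unfolding eq by (auto simp: cline_def)
      have "(1::complex) = (x *s axis k' 1) $ k" unfolding x[symmetric] by (simp add: axis_def)
      then show ?thesis by (simp add: axis_def split: if_splits)
    qed
    then show ?thesis using that A' no no[symmetric] unfolding A1 by blast
  qed
  moreover have "\<exists>c\<in>blowup q A. \<exists>z l. fst c z = Exc ((P @ [q]) ! n) l" if n: "n < length (P @ [q])" for n
  proof (cases "n = length P")
    case True
    then have "fst (blowup_chart k c0) 0 = Exc ((P @ [q]) ! n) (cline (axis k 1))" for k by (simp add: ob)
    then show ?thesis unfolding A1 by blast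
  next
    case False
    then have n: "n < length P" using n by simp
    then obtain c z l where c: "c \<in> A" "fst c z = Exc (P ! n) l" using A' by blast
    show ?thesis
    proof (cases "q \<in> range (fst c)")
      case False
      then show ?thesis using c n unfolding A1 by (auto simp: nth_append)
    next
      case True
      then have cc: "c = c0" using origin uniq c(1) by blast
      then obtain k S where k: "k \<notin> S" "{z. \<exists>l. fst c0 z = Exc (P ! n) l} = {z. z $ k = 0 \<and> (\<forall>m\<in>S. z $ m \<noteq> 0)}"

        using monomial_chartD(7)[OF M n] c(2) by blast
      have "\<exists>k'. k' \<noteq> k"
      proof (rule ccontr)
        assume "\<nexists>k'. k' \<noteq> k"
        then have "(UNIV :: 'd set) = {k}" by auto
        then have "CARD('d) = card {k}" by (rule arg_cong)
        then show False using d by simp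
      qed
      then obtain k' where k': "k' \<noteq> k" by blast
      \<comment> \<open>A point of the divisor off all other coordinate hyperplanes, with the same coordinates in both charts.\<close>
      define y :: "complex ^ 'd" where "y = (\<chi> m. if m = k then 0 else 1)"
      have "blowup_coords k' y = y" using k' by (auto simp: y_def vec_eq_iff blowup_coords_nth)
      moreover have "y \<in> {z. \<exists>l. fst c0 z = Exc (P ! n) l}" unfolding k(2) using k(1) by (auto simp: y_def)
      ultimately have "\<exists>l. fst (blowup_chart k' c0) y = Exc (P ! n) l"
        using k' by (simp add: fst_blowup_chart) (simp add: y_def)
      then show ?thesis using n unfolding A1 by (auto simp: nth_append)
    qed
  qed
  moreover have "w' n i \<ge> 1" if "n < length (P @ [q])" for n i
  proof (cases "n = length P")
    case True
    have "monomial_map M 0 = 0" using monomial_chartD(5)[OF M, of 0] c00 q(3) by simp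
    then have "(\<Prod>m\<in>UNIV. (0::complex) ^ M i m) = 0" by (simp add: monomial_map_def vec_eq_iff)
    then obtain m where "M i m > 0" by (auto simp: prod_zero_iff)
    then have "M i m \<le> (\<Sum>m\<in>UNIV. M i m)" by (intro member_le_sum) auto
    then show ?thesis using \<open>M i m > 0\<close> True by (simp add: w'_def)
  next
    case False
    then show ?thesis using that A' by (simp add: w'_def)
  qed
  moreover have "q' \<in> set (P @ [q])" if "Exc q' l \<in> set (P @ [q])" for q' l
  proof (cases "Exc q' l = q")
    case True
    then show ?thesis using exc[OF c0(1), of 0 q' l] c00 by simp
  next
    case False
    then have "Exc q' l \<in> set P" using that by simp
    then show ?thesis using A' by auto
  qed
  moreover have "\<forall>q\<in>set (P @ [q]). blow_down q = 0" using A' q(3) by auto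
  ultimately show ?thesis unfolding toric_atlas_def by blast
qed

lemma toric_atlas_affine_space: "toric_atlas [] w (affine_space_charts :: 'd::finite chart set)"
proof -
  let ?M = "\<lambda>i m. if m = i then 1 else 0 :: nat"
  have id: "(\<Prod>m\<in>UNIV. r m ^ ?M i m) = r i" for i and r :: "'d \<Rightarrow> complex"
  proof -
    have "(\<Prod>m\<in>UNIV. r m ^ ?M i m) = (\<Prod>m\<in>UNIV. if m = i then r m else 1)" by (rule prod.cong) auto
    then show ?thesis by simp
  qed
  have "monomial_chart [] w ((Base, id) :: 'd chart) ?M"
    unfolding monomial_chart_def unitary_surjective_def monomial_map_def id by (auto simp: inj_on_def)
  then show ?thesis by (auto simp: toric_atlas_def affine_space_charts_def)
qed

lemma toric_atlas_iterated_blowup: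
  fixes C :: "(complex ^ 'd::finite) bl_point list"
  assumes d: "CARD('d) \<ge> 2" and C: "toric_constellation C" and j: "j \<le> length C"
  shows "\<exists>w. toric_atlas (take j C) w (iterated_blowup (take j C))"
  using j
proof (induction j)
  case 0
  then show ?case using toric_atlas_affine_space by (auto simp: iterated_blowup_def)
next
  case (Suc j)
  let ?A = "iterated_blowup (take j C)"
  obtain w where w: "toric_atlas (take j C) w ?A" using Suc by auto
  have "C ! j \<in> space_points ?A \<and> torus_orbit ?A (C ! j) = {C ! j} \<and> blow_down (C ! j) = 0"
  proof (cases "j = 0")
    case True
    have A: "?A = {(Base, id)}" using True by (simp add: iterated_blowup_def affine_space_charts_def)
    have C0: "C ! j = Base 0" using True C by (simp add: toric_constellation_def)
    have "Base 0 \<in> torus_orbit ?A (Base 0)"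
      unfolding torus_orbit_def A
      by (intro CollectI exI[of _ Base] exI[of _ id] exI[of _ 0] exI[of _ "\<chi> i. 1"])
        (auto simp: vec_eq_iff torus_def)
    moreover have "torus_orbit ?A (Base 0) \<subseteq> {Base 0}"
      unfolding torus_orbit_def A by (auto simp: vec_eq_iff)
    ultimately have "torus_orbit ?A (Base 0) = {Base 0}" by blast
    then show ?thesis unfolding C0 A by (simp add: space_points_def)
  next
    case False
    then show ?thesis using C Suc.prems by (simp add: toric_constellation_def)
  qed
  moreover have "take (Suc j) C = take j C @ [C ! j]" using Suc.prems by (simp add: take_Suc_conv_app_nth)
  moreover have "iterated_blowup (take j C @ [C ! j]) = blowup (C ! j) ?A" by (simp add: iterated_blowup_def)
  ultimately show ?case using toric_atlas_blowup[OF w d] by simp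
qed

lemma closure_hyperplane_part:
  fixes k :: "'d::finite"
  assumes "k \<notin> S"
  shows "closure {z :: complex ^ 'd. z $ k = 0 \<and> (\<forall>m\<in>S. z $ m \<noteq> 0)} = {z. z $ k = 0}"
proof
  have "closed {z :: complex ^ 'd. z $ k = 0}" by (intro closed_Collect_eq continuous_intros)
  then show "closure {z :: complex ^ 'd. z $ k = 0 \<and> (\<forall>m\<in>S. z $ m \<noteq> 0)} \<subseteq> {z. z $ k = 0}"
    by (intro closure_minimal) auto
  show "{z. z $ k = 0} \<subseteq> closure {z :: complex ^ 'd. z $ k = 0 \<and> (\<forall>m\<in>S. z $ m \<noteq> 0)}"
  proof
    fix z :: "complex ^ 'd" assume z: "z \<in> {z. z $ k = 0}"
    define x :: "nat \<Rightarrow> complex ^ 'd" where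
      "x = (\<lambda>n. \<chi> m. if m \<in> S \<and> z $ m = 0 then of_real (inverse (real (Suc n))) else z $ m)"
    have "x n \<in> {z. z $ k = 0 \<and> (\<forall>m\<in>S. z $ m \<noteq> 0)}" for n
      using z assms by (auto simp: x_def simp del: of_nat_Suc)
    moreover have "x \<longlonglongrightarrow> z"
    proof (rule vec_tendstoI)
      fix m
      have "(\<lambda>n. of_real (inverse (real (Suc n))) :: complex) \<longlonglongrightarrow> of_real 0"
        by (intro tendsto_of_real LIMSEQ_inverse_real_of_nat)
      then show "(\<lambda>n. x n $ m) \<longlonglongrightarrow> z $ m" by (cases "m \<in> S \<and> z $ m = 0") (auto simp: x_def)
    qed
    ultimately show "z \<in> closure {z. z $ k = 0 \<and> (\<forall>m\<in>S. z $ m \<noteq> 0)}"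
      unfolding closure_sequential by blast
  qed
qed

section \<open>The divisorial valuations are monomial\<close>

text \<open>In other words, \<open>\<nu>\<^sub>j\<close> is the monomial valuation with the positive weights \<open>w j\<close>. Phrasing it by lower bounds covers
  the zero germ, whose valuation is infinite.\<close>

definition valuation_weights :: "(complex ^ 'd::finite) bl_point list \<Rightarrow> (nat \<Rightarrow> 'd \<Rightarrow> nat) \<Rightarrow> bool" where
  "valuation_weights C w \<longleftrightarrow> (\<forall>j<length C. (\<forall>i. w j i \<ge> 1) \<and>
     (\<forall>g a \<rho> n. expansion_at 0 g a \<rho> \<longrightarrow>
        (enat n \<le> divisorial_valuation C j g \<longleftrightarrow> (\<forall>\<alpha>. a \<alpha> \<noteq> 0 \<longrightarrow> n \<le> (\<Sum>i\<in>UNIV. w j i * \<alpha> $ i)))))"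

text \<open>Sufficiency of the exponent condition has to be checked at all points of the strict transform;
  for necessity the origin of one chart meeting the divisor is enough.\<close>

theorem valuation_weights_exist:
  fixes C :: "(complex ^ 'd::finite) bl_point list"
  assumes d: "CARD('d) \<ge> 2" and C: "toric_constellation C"
  shows "\<exists>w. valuation_weights C w"
proof -
  obtain w where w: "toric_atlas C w (iterated_blowup C)"
    using toric_atlas_iterated_blowup[OF d C, of "length C"] by auto
  note w' = w[unfolded toric_atlas_def]
  have "enat n \<le> divisorial_valuation C j g \<longleftrightarrow> (\<forall>\<alpha>. a \<alpha> \<noteq> 0 \<longrightarrow> n \<le> (\<Sum>i\<in>UNIV. w j i * \<alpha> $ i))"
    if j: "j < length C" and a: "expansion_at 0 g a \<rho>" for j g a \<rho> n
  proof -
    let ?van = "\<lambda>n. \<forall>c \<in> iterated_blowup C. \<forall>p \<in> strict_transform_in c (C ! j).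
      vanishes_to_order_at (strict_transform_in c (C ! j)) p n (\<lambda>z. g (blow_down (fst c z)))"
    let ?ord = "\<lambda>n. \<forall>\<alpha>. a \<alpha> \<noteq> 0 \<longrightarrow> n \<le> (\<Sum>i\<in>UNIV. w j i * \<alpha> $ i)"
    have w1: "\<And>i. w j i \<ge> 1" using w' j by blast
    have st: "strict_transform_in c (C ! j) = {} \<or> (\<exists>k M. strict_transform_in c (C ! j) = {z. z $ k = 0} \<and>
        (\<forall>i. M i k = w j i) \<and> (\<forall>z. blow_down (fst c z) = monomial_map M z) \<and> unitary_surjective M)"
      if c: "c \<in> iterated_blowup C" for c
    proof -
      obtain M where M: "monomial_chart C w c M" using w' c by blast
      then consider "{z. \<exists>l. fst c z = Exc (C ! j) l} = {}" |
        k S where "k \<notin> S" "{z. \<exists>l. fst c z = Exc (C ! j) l} = {z. z $ k = 0 \<and> (\<forall>m\<in>S. z $ m \<noteq> 0)}"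
          "\<forall>i. M i k = w j i"
        using monomial_chartD(7)[OF M j] by blast
      then show ?thesis
      proof cases
        case 1
        then show ?thesis by (simp add: strict_transform_in_def)
      next
        case 2
        then have "strict_transform_in c (C ! j) = {z. z $ k = 0}"
          unfolding strict_transform_in_def 2(2) by (simp add: closure_hyperplane_part)
        then show ?thesis using 2(3) monomial_chartD(5,6)[OF M] by blast
      qed
    qed
    have van_ord: "?van n \<longleftrightarrow> ?ord n" for n
    proof
      assume van: "?van n"
      obtain c z l where c: "c \<in> iterated_blowup C" "fst c z = Exc (C ! j) l" using w' j by blast
      have "z \<in> strict_transform_in c (C ! j)"
        unfolding strict_transform_in_def by (rule subsetD[OF closure_subset]) (use c(2) in blast)
      then obtain k M where k: "strict_transform_in c (C ! j) = {z. z $ k = 0}" "\<And>i. M i k = w j i"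
          "\<And>z. blow_down (fst c z) = monomial_map M z" "unitary_surjective M"
        using st[OF c(1)] by blast
      have "vanishes_to_order_at {z. z $ k = 0} 0 n (\<lambda>z. g (monomial_map M z))"
        using van[rule_format, OF c(1), of 0] unfolding k(1,3) by simp
      moreover have "\<exists>\<eta>. (\<forall>m. norm (\<eta> m) = 1) \<and> (\<forall>i. (\<Prod>m\<in>UNIV. \<eta> m ^ M i m) = \<zeta> i)"
        if "\<And>i. norm (\<zeta> i) = 1" for \<zeta> :: "'d \<Rightarrow> complex"
        using k(4) that unfolding unitary_surjective_def by blast
      ultimately show "?ord n"
        using pullback_vanishes_only_if[OF a, of M k n] w1 k(2) by simp
    next
      assume ord: "?ord n"
      show "?van n"
      proof (intro ballI)
        fix c p assume c: "c \<in> iterated_blowup C" and p: "p \<in> strict_transform_in c (C ! j)"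
        then obtain k M where k: "strict_transform_in c (C ! j) = {z. z $ k = 0}" "\<And>i. M i k = w j i"
            "\<And>z. blow_down (fst c z) = monomial_map M z"
          using st[OF c] by blast
        show "vanishes_to_order_at (strict_transform_in c (C ! j)) p n (\<lambda>z. g (blow_down (fst c z)))"
          unfolding k(1,3) by (rule pullback_vanishes[OF a]) (use p k w1 ord in auto)
      qed
    qed
    have val: "divisorial_valuation C j g = Sup {enat n | n. ?ord n}"
      unfolding divisorial_valuation_def van_ord ..
    show ?thesis
    proof
      assume "?ord n"
      then show "enat n \<le> divisorial_valuation C j g" unfolding val by (intro Sup_upper) blast
    next
      assume le: "enat n \<le> divisorial_valuation C j g"
      show "?ord n"
      proof (intro allI impI)
        fix \<alpha> assume "a \<alpha> \<noteq> 0"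
        then have "divisorial_valuation C j g \<le> enat (\<Sum>i\<in>UNIV. w j i * \<alpha> $ i)"
          unfolding val by (intro Sup_least) auto
        then show "n \<le> (\<Sum>i\<in>UNIV. w j i * \<alpha> $ i)" using le by (metis enat_ord_simps(1) order.trans)
      qed
    qed
  qed
  then show ?thesis unfolding valuation_weights_def using w' by blast
qed

section \<open>Formal series\<close>

lemma int_vectors_iff: "v \<in> int_vectors r \<longleftrightarrow> (\<forall>j\<ge>r. Poly_Mapping.lookup v j = 0)"
  by (auto simp: int_vectors_def in_keys_iff subset_iff not_less[symmetric])

lemma lookup_ones: "Poly_Mapping.lookup (ones r) j = (if j < r then 1 else 0)"
  by (simp add: ones_def lookup_sum lookup_single when_def)

lemma series_mult_superset:
  assumes "finite K" "Poly_Mapping.keys D \<subseteq> K"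
  shows "series_mult D F v = (\<Sum>w\<in>K. Poly_Mapping.lookup D w * F (v - w))"
  unfolding series_mult_def
  by (rule sum.mono_neutral_left) (use assms in \<open>auto simp: in_keys_iff\<close>)

lemma series_mult_add: "series_mult (D + E) F v = series_mult D F v + series_mult E F v"
proof -
  let ?K = "Poly_Mapping.keys D \<union> Poly_Mapping.keys E"
  have "Poly_Mapping.keys (D + E) \<subseteq> ?K" by (rule Poly_Mapping.keys_add)
  then show ?thesis
    by (simp add: series_mult_superset[of ?K] lookup_add algebra_simps sum.distrib)
qed

lemma series_mult_diff: "series_mult (D - E) F v = series_mult D F v - series_mult E F v"
  using series_mult_add[of "D - E" E F v] by simp

lemma series_mult_single: "series_mult (Poly_Mapping.single a c) F v = c * F (v - a)"
  by (simp add: series_mult_superset[of "{a}"])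

lemma series_mult_one: "series_mult 1 F = F"
  by (rule ext) (simp add: series_mult_single flip: single_one)

lemma series_mult_t_pow_times: "series_mult (t_pow a * D) F v = series_mult D F (v - a)"
proof (induction D rule: update_induct)
  case const
  then show ?case by (simp add: series_mult_def)
next
  case (update f k b)
  have u: "Poly_Mapping.update k b f = f + Poly_Mapping.single k b"
    using update(1) by (intro poly_mapping_eqI)
      (auto simp: lookup_update lookup_add lookup_single in_keys_iff when_def)
  show ?case
    unfolding u using update(3)
    by (simp add: ring_distribs series_mult_add t_pow_def mult_single series_mult_single algebra_simps)
qed

text \<open>Identifies a Laurent polynomial with its action on the series \<open>1\<close>, so that coefficients of products
  follow from the rules for the action.\<close>

lemma lookup_eq_series_mult: "Poly_Mapping.lookup D v = series_mult D (Poly_Mapping.lookup 1) v"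
proof (cases "v \<in> Poly_Mapping.keys D")
  case True
  have "series_mult D (Poly_Mapping.lookup 1) v =
      (\<Sum>w\<in>Poly_Mapping.keys D. if w = v then Poly_Mapping.lookup D w else 0)"
    unfolding series_mult_def by (rule sum.cong) (auto simp: lookup_one when_def)
  then show ?thesis using True by simp
next
  case False
  then have "series_mult D (Poly_Mapping.lookup 1) v = 0"
    unfolding series_mult_def by (intro sum.neutral) (auto simp: lookup_one when_def)
  then show ?thesis using False by (simp add: in_keys_iff)
qed

lemma lookup_t_pow_times: "Poly_Mapping.lookup (t_pow a * D) v = Poly_Mapping.lookup D (v - a)"
  by (simp only: lookup_eq_series_mult[of D] lookup_eq_series_mult[of "t_pow a * D"] series_mult_t_pow_times)

lemma series_mult_cong:
  assumes "\<And>w. w \<in> Poly_Mapping.keys D \<Longrightarrow> F (v - w) = F' (v - w)"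
  shows "series_mult D F v = series_mult D F' v"
  unfolding series_mult_def using assms by simp

lemma series_mult_sum:
  "series_mult D (\<lambda>v. \<Sum>x\<in>U. F x v) v = (\<Sum>x\<in>U. series_mult D (F x) v)"
  unfolding series_mult_def by (simp add: sum_distrib_left sum.swap[of _ U])

lemma series_mult_shift_diff:
  "series_mult D (\<lambda>v. F v - F (v + a)) v = series_mult D F v - series_mult D F (v + a)"
  unfolding series_mult_def by (simp add: right_diff_distrib sum_subtractf algebra_simps)

lemma series_quotient_eqI:
  assumes "Poly_Mapping.keys D \<subseteq> nonneg_vectors r" "\<bar>Poly_Mapping.lookup D 0\<bar> = 1"
    and G: "G \<in> power_series r" and F: "series_mult D G = F"
  shows "series_quotient r F D = G"
proof -
  have "F \<in> power_series r"
    unfolding power_series_def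
  proof (intro CollectI allI impI)
    fix v assume "F v \<noteq> 0"
    then have "(\<Sum>w\<in>Poly_Mapping.keys D. Poly_Mapping.lookup D w * G (v - w)) \<noteq> 0"
      unfolding F[symmetric] series_mult_def .
    then obtain w where w: "w \<in> Poly_Mapping.keys D" "G (v - w) \<noteq> 0"
      by (metis (no_types, lifting) mult_eq_0_iff sum.neutral)
    have "v = w + (v - w)" by simp
    moreover have "w \<in> nonneg_vectors r" "v - w \<in> nonneg_vectors r"
      using w assms(1) G by (auto simp: power_series_def)
    moreover have "x + y \<in> nonneg_vectors r" if "x \<in> nonneg_vectors r" "y \<in> nonneg_vectors r" for x y
      using that by (auto simp: nonneg_vectors_def int_vectors_iff lookup_add)
    ultimately show "v \<in> nonneg_vectors r" by metis
  qed
  from series_quotient_unique[OF assms(1,2) this] show ?thesis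
    unfolding series_quotient_def using G F by (intro the1_equality) auto
qed

text \<open>The expansion of \<open>t^w\<close> times the product over \<open>j\<close> of \<open>1 + t\<^sub>j^(-1) + t\<^sub>j^(-2) + \<cdots>\<close>.\<close>

definition orthant :: "nat \<Rightarrow> ivec \<Rightarrow> formal_series" where
  "orthant r w = (\<lambda>v. if v \<in> int_vectors r \<and> (\<forall>j<r. Poly_Mapping.lookup v j \<le> Poly_Mapping.lookup w j)
     then 1 else 0)"

text \<open>Each factor \<open>t\<^sub>k - 1\<close> is a difference operator in direction \<open>k\<close> and sharpens the inequality
  \<open>v\<^sub>k \<le> w\<^sub>k\<close> to \<open>v\<^sub>k = w\<^sub>k + 1\<close>.\<close>

lemma orthant_partial_difference:
  assumes "k \<le> r"
  shows "series_mult (\<Prod>j<k. t_var j - 1) (orthant r w) v =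
    (if v \<in> int_vectors r \<and> (\<forall>j<k. Poly_Mapping.lookup v j = Poly_Mapping.lookup w j + 1)
      \<and> (\<forall>j. k \<le> j \<and> j < r \<longrightarrow> Poly_Mapping.lookup v j \<le> Poly_Mapping.lookup w j) then 1 else 0)"
    (is "_ = ?R k v")
  using assms
proof (induction k arbitrary: v)
  case 0
  then show ?case by (simp add: series_mult_one orthant_def)
next
  case (Suc k)
  let ?e = "Poly_Mapping.single k (1::int)"
  have "series_mult (\<Prod>j<Suc k. t_var j - 1) (orthant r w) v = ?R k (v - ?e) - ?R k v"
    unfolding prod.lessThan_Suc using Suc
    by (subst mult.commute) (simp add: left_diff_distrib series_mult_diff t_var_def series_mult_t_pow_times)
  also have "\<dots> = ?R (Suc k) v"
  proof -
    have iv: "v - ?e \<in> int_vectors r \<longleftrightarrow> v \<in> int_vectors r"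
      using Suc.prems by (auto simp: int_vectors_iff lookup_minus lookup_single when_def)
    have lk: "Poly_Mapping.lookup (v - ?e) j = Poly_Mapping.lookup v j - (if j = k then 1 else 0)" for j
      by (simp add: lookup_minus lookup_single when_def)
    have 1: "(\<forall>j<k. Poly_Mapping.lookup (v - ?e) j = Poly_Mapping.lookup w j + 1) \<longleftrightarrow>
        (\<forall>j<k. Poly_Mapping.lookup v j = Poly_Mapping.lookup w j + 1)"
      by (auto simp: lk)
    have split: "(\<forall>j. k \<le> j \<and> j < r \<longrightarrow> P j) \<longleftrightarrow> P k \<and> (\<forall>j. Suc k \<le> j \<and> j < r \<longrightarrow> P j)" for P
      using Suc.prems by (metis Suc_le_eq le_eq_less_or_eq)
    have 2: "(\<forall>j. k \<le> j \<and> j < r \<longrightarrow> Poly_Mapping.lookup (v - ?e) j \<le> Poly_Mapping.lookup w j) \<longleftrightarrow>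
        Poly_Mapping.lookup v k \<le> Poly_Mapping.lookup w k + 1 \<and>
        (\<forall>j. Suc k \<le> j \<and> j < r \<longrightarrow> Poly_Mapping.lookup v j \<le> Poly_Mapping.lookup w j)"
      unfolding split[of "\<lambda>j. Poly_Mapping.lookup (v - ?e) j \<le> Poly_Mapping.lookup w j"] unfolding lk by auto
    have 3: "(\<forall>j. k \<le> j \<and> j < r \<longrightarrow> Poly_Mapping.lookup v j \<le> Poly_Mapping.lookup w j) \<longleftrightarrow>
        Poly_Mapping.lookup v k \<le> Poly_Mapping.lookup w k \<and>
        (\<forall>j. Suc k \<le> j \<and> j < r \<longrightarrow> Poly_Mapping.lookup v j \<le> Poly_Mapping.lookup w j)"
      by (rule split)
    show ?thesis unfolding iv 1 2 3 by (auto simp: less_Suc_eq)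
  qed
  finally show ?case .
qed

lemma orthant_difference:
  assumes "w \<in> int_vectors r"
  shows "series_mult (\<Prod>j<r. t_var j - 1) (orthant r w) v = (if v = w + ones r then 1 else 0)"
proof -
  have "v = w + ones r \<longleftrightarrow> v \<in> int_vectors r \<and> (\<forall>j<r. Poly_Mapping.lookup v j = Poly_Mapping.lookup w j + 1)"
  proof
    assume "v \<in> int_vectors r \<and> (\<forall>j<r. Poly_Mapping.lookup v j = Poly_Mapping.lookup w j + 1)"
    then show "v = w + ones r"
      using assms by (intro poly_mapping_eqI) (force simp: int_vectors_iff lookup_add lookup_ones not_less)
  qed (use assms in \<open>auto simp: int_vectors_iff lookup_add lookup_ones\<close>)
  then show ?thesis by (auto simp: orthant_partial_difference)
qed

lemma prod_t_var: "(\<Prod>j<r. t_var j) = t_pow (ones r)"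
proof (induction r)
  case (Suc r)
  then show ?case by (simp add: t_pow_def t_var_def mult_single ones_def)
qed (simp add: t_pow_def ones_def)

lemma sum_indicator_card:
  "finite U \<Longrightarrow> {x. P x} \<subseteq> U \<Longrightarrow> (\<Sum>x\<in>U. if P x then 1 else 0 :: int) = int (card {x. P x})"
  by (subst sum.inter_filter[symmetric]) (auto intro!: arg_cong[where f = card])

text \<open>For a given coefficient \<open>v\<close> only the finitely many \<open>x\<close> in \<open>U\<close> contribute to either side, which allows
  the sum over \<open>x\<close> to be exchanged with the action of the Laurent polynomial. Each \<open>x\<close> then contributes
  \<open>t^(W x + 1) - t^(W x)\<close>.\<close>

lemma poincare_numerator:
  fixes W :: "'x \<Rightarrow> ivec"
  assumes W: "\<And>x. W x \<in> int_vectors r"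
    and fin: "\<And>j n. j < r \<Longrightarrow> finite {x. Poly_Mapping.lookup (W x) j = n}"
    and r: "r > 0"
  shows "series_mult (\<Prod>j<r. t_var j - 1) (\<lambda>v. if v \<in> int_vectors r then
       int (card {x. (\<forall>j<r. Poly_Mapping.lookup v j \<le> Poly_Mapping.lookup (W x) j) \<and>
                     (\<exists>j<r. Poly_Mapping.lookup v j = Poly_Mapping.lookup (W x) j)}) else 0) =
     series_mult ((\<Prod>j<r. t_var j) - 1) (\<lambda>v. int (card {x. W x = v}))" (is "series_mult ?D ?L = series_mult _ ?G")
proof
  fix v
  define U where "U = (\<Union>j\<in>{..<r}. \<Union>u\<in>insert v (insert (v - ones r) ((-) v ` Poly_Mapping.keys ?D)).
      {x. Poly_Mapping.lookup (W x) j = Poly_Mapping.lookup u j})"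
  have U: "finite U" unfolding U_def by (intro finite_UN_I) (auto intro!: fin)
  have L: "?L u = (\<Sum>x\<in>U. orthant r (W x) u - orthant r (W x) (u + ones r))"
    if "u \<in> (-) v ` Poly_Mapping.keys ?D" for u
  proof (cases "u \<in> int_vectors r")
    case True
    then have "u + ones r \<in> int_vectors r" by (auto simp: int_vectors_iff lookup_add lookup_ones)
    then have *: "orthant r (W x) u - orthant r (W x) (u + ones r) =
        (if (\<forall>j<r. Poly_Mapping.lookup u j \<le> Poly_Mapping.lookup (W x) j) \<and>
            (\<exists>j<r. Poly_Mapping.lookup u j = Poly_Mapping.lookup (W x) j) then 1 else 0)" for x
      using True by (force simp: orthant_def lookup_add lookup_ones)
    show ?thesis
      unfolding * using True that U by (subst sum_indicator_card) (force simp: U_def)+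
  next
    case False
    then have "u + ones r \<notin> int_vectors r" by (auto simp: int_vectors_iff lookup_add lookup_ones)
    then show ?thesis using False by (simp add: orthant_def)
  qed
  have G: "?G u = (\<Sum>x\<in>U. if W x = u then 1 else 0)" if "u = v \<or> u = v - ones r" for u
    using U that r by (subst sum_indicator_card) (auto simp: U_def)
  have "series_mult ?D ?L v =
      series_mult ?D (\<lambda>u. \<Sum>x\<in>U. orthant r (W x) u - orthant r (W x) (u + ones r)) v"
    by (rule series_mult_cong) (rule L, blast)
  also have "\<dots> = (\<Sum>x\<in>U. (if v = W x + ones r then 1 else 0) - (if v = W x then 1 else 0))"
    unfolding series_mult_sum series_mult_shift_diff by (simp add: orthant_difference W)
  also have "\<dots> = ?G (v - ones r) - ?G v"
  proof -
    have "v = W x + ones r \<longleftrightarrow> W x = v - ones r" "v = W x \<longleftrightarrow> W x = v" for x by (auto simp: algebra_simps)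
    then show ?thesis unfolding sum_subtractf by (subst (1 2) G) simp_all
  qed
  also have "\<dots> = series_mult ((\<Prod>j<r. t_var j) - 1) ?G v"
    using series_mult_t_pow_times[of "ones r" 1 ?G v]
    by (simp add: prod_t_var series_mult_diff series_mult_one)
  finally show "series_mult ?D ?L v = series_mult ((\<Prod>j<r. t_var j) - 1) ?G v" .
qed

text \<open>Multiplication by \<open>1 - t^(c i)\<close> discards the exponents with \<open>\<alpha>\<^sub>i > 0\<close>, because these are the shifts by
  the \<open>i\<close>-th unit vector of all exponents. Removing the variables one after another leaves \<open>\<alpha> = 0\<close>.\<close>

lemma series_mult_geometric:
  fixes W :: "nat ^ 'd::finite \<Rightarrow> ivec"
  assumes W0: "W 0 = 0" and W1: "\<And>\<alpha> i. W (\<alpha> + axis i 1) = W \<alpha> + c i"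
    and fin: "\<And>v. finite {\<alpha>. W \<alpha> = v}" and "finite S"
  shows "series_mult (\<Prod>i\<in>S. 1 - t_pow (c i)) (\<lambda>v. int (card {\<alpha>. (\<forall>i. i \<notin> S \<longrightarrow> \<alpha> $ i = 0) \<and> W \<alpha> = v}))
    = Poly_Mapping.lookup 1"
  using \<open>finite S\<close>
proof (induction S rule: finite_induct)
  case empty
  have "{\<alpha>. (\<forall>i. i \<notin> {} \<longrightarrow> \<alpha> $ i = 0) \<and> W \<alpha> = v} = (if v = 0 then {0} else {})" for v
    using W0 by (auto simp: vec_eq_iff) (metis (mono_tags) vec_eq_iff zero_index)+
  then show ?case by (auto simp: series_mult_one lookup_one when_def)
next
  case (insert i S)
  let ?A = "\<lambda>S v. {\<alpha>. (\<forall>i. i \<notin> S \<longrightarrow> \<alpha> $ i = 0) \<and> W \<alpha> = v}"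
  let ?G = "\<lambda>S v. int (card (?A S v))"
  let ?P = "\<Prod>i\<in>S. 1 - t_pow (c i)"
  have fA: "finite (?A S v)" for S v by (rule finite_subset[OF _ fin[of v]]) auto
  have step: "?G (insert i S) u - ?G (insert i S) (u - c i) = ?G S u" for u
  proof -
    have axis_nth: "(axis i 1 :: nat ^ 'd) $ m = (if m = i then 1 else 0)" for m by (simp add: axis_def)
    have decomp: "?A (insert i S) u = ?A S u \<union> (\<lambda>\<alpha>. \<alpha> + axis i 1) ` ?A (insert i S) (u - c i)"
    proof (intro equalityI subsetI)
      fix \<alpha> assume \<alpha>: "\<alpha> \<in> ?A (insert i S) u"
      show "\<alpha> \<in> ?A S u \<union> (\<lambda>\<alpha>. \<alpha> + axis i 1) ` ?A (insert i S) (u - c i)"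
      proof (cases "\<alpha> $ i = 0")
        case False
        define \<beta> where "\<beta> = (\<chi> m. if m = i then \<alpha> $ m - 1 else \<alpha> $ m)"
        have \<beta>: "\<alpha> = \<beta> + axis i 1" using False by (auto simp: vec_eq_iff \<beta>_def axis_def)
        moreover have "\<beta> \<in> ?A (insert i S) (u - c i)"
        proof -
          have "W \<beta> = u - c i" using \<alpha> W1[of \<beta> i] unfolding \<beta>[symmetric] by (simp add: eq_diff_eq)
          then show ?thesis using \<alpha> by (auto simp: \<beta>_def)
        qed
        ultimately show ?thesis by blast
      next
        case True
        have "\<alpha> $ m = 0" if "m \<notin> S" for m
          using \<alpha> True that by (cases "m = i") auto
        then have "\<alpha> \<in> ?A S u" using \<alpha> by blast
        then show ?thesis by blast
      qed
    qed (auto simp: W1 axis_nth simp del: One_nat_def)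
    have disj: "?A S u \<inter> (\<lambda>\<alpha>. \<alpha> + axis i 1) ` ?A (insert i S) (u - c i) = {}"
      using insert(2) by (auto simp: axis_def)
    have "card ((\<lambda>\<alpha>. \<alpha> + axis i 1) ` ?A (insert i S) (u - c i)) = card (?A (insert i S) (u - c i))"
      by (rule card_image) (simp add: inj_on_def)
    then show ?thesis
      unfolding decomp card_Un_disjoint[OF fA finite_imageI[OF fA] disj] by simp
  qed
  have "series_mult (\<Prod>i\<in>insert i S. 1 - t_pow (c i)) (?G (insert i S)) v = series_mult ?P (?G S) v" for v
  proof -
    have "series_mult (\<Prod>i\<in>insert i S. 1 - t_pow (c i)) F v = series_mult ?P F v - series_mult ?P F (v - c i)" for F
      using insert(1,2) by (simp add: left_diff_distrib series_mult_diff series_mult_t_pow_times)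
    also have "series_mult ?P F v - series_mult ?P F (v - c i) = series_mult ?P (\<lambda>u. F u - F (u - c i)) v" for F
      using series_mult_shift_diff[of ?P F "- c i" v] by simp
    finally show ?thesis by (simp only: step)
  qed
  then show ?case using insert.IH by (simp only: fun_eq_iff simp_thms)
qed

text \<open>The hypotheses under which division by the denominator is well defined in \<open>\<int>[[t]]\<close>.\<close>

lemma geometric_denominator:
  fixes c :: "'i \<Rightarrow> ivec"
  assumes "finite S" and c: "\<And>i. c i \<in> nonneg_vectors r" "\<And>i. c i \<noteq> 0"
  shows "Poly_Mapping.keys (\<Prod>i\<in>S. 1 - t_pow (c i)) \<subseteq> nonneg_vectors r \<and>
    Poly_Mapping.lookup (\<Prod>i\<in>S. 1 - t_pow (c i)) 0 = 1"
  using assms(1)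
proof (induction S rule: finite_induct)
  case empty
  then show ?case by (auto simp: nonneg_vectors_def int_vectors_iff)
next
  case (insert i S)
  let ?P = "\<Prod>i\<in>S. 1 - t_pow (c i)"
  have P: "(\<Prod>i\<in>insert i S. 1 - t_pow (c i)) = ?P - t_pow (c i) * ?P"
    using insert by (simp add: left_diff_distrib)
  have "v \<in> nonneg_vectors r" if "v - c i \<in> nonneg_vectors r" for v
  proof -
    have "0 \<le> Poly_Mapping.lookup v j" "j \<ge> r \<Longrightarrow> Poly_Mapping.lookup v j = 0" for j
      using that c(1)[of i] unfolding nonneg_vectors_def int_vectors_iff mem_Collect_eq lookup_minus
      by (smt (verit))+
    then show ?thesis by (auto simp: nonneg_vectors_def int_vectors_iff)
  qed
  moreover have "- c i \<notin> nonneg_vectors r"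
  proof
    assume "- c i \<in> nonneg_vectors r"
    then have "Poly_Mapping.lookup (c i) j = 0" for j
      using c(1)[of i] unfolding nonneg_vectors_def mem_Collect_eq lookup_uminus
      by (smt (verit))
    then show False using c(2)[of i] by (metis poly_mapping_eqI lookup_zero)
  qed
  ultimately show ?case
    using insert.IH unfolding P
    by (simp add: in_keys_iff lookup_minus lookup_t_pow_times subset_iff) metis
qed

theorem poincare_quotient:
  fixes W :: "nat ^ 'd::finite \<Rightarrow> ivec"
  assumes W: "\<And>\<alpha>. W \<alpha> \<in> nonneg_vectors r" "W 0 = 0" "\<And>\<alpha> i. W (\<alpha> + axis i 1) = W \<alpha> + c i"
    and c: "\<And>i. c i \<noteq> 0"
    and fin: "\<And>j n. j < r \<Longrightarrow> finite {\<alpha>. Poly_Mapping.lookup (W \<alpha>) j = n}"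
    and r: "r > 0"
  shows "series_quotient r (series_mult (\<Prod>j<r. t_var j - 1) (\<lambda>v. if v \<in> int_vectors r then
       int (card {\<alpha>. (\<forall>j<r. Poly_Mapping.lookup v j \<le> Poly_Mapping.lookup (W \<alpha>) j) \<and>
                     (\<exists>j<r. Poly_Mapping.lookup v j = Poly_Mapping.lookup (W \<alpha>) j)}) else 0))
       ((\<Prod>j<r. t_var j) - 1) =
     series_quotient r (Poly_Mapping.lookup 1) (\<Prod>i\<in>UNIV. 1 - t_pow (c i))"
proof -
  let ?G = "\<lambda>v. int (card {\<alpha>. W \<alpha> = v})"
  have fin1: "finite {\<alpha>. W \<alpha> = v}" for v
    by (rule finite_subset[OF _ fin[OF r, of "Poly_Mapping.lookup v 0"]]) auto
  have G: "?G \<in> power_series r"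
    unfolding power_series_def using W(1) by (auto simp: card_gt_0_iff)
  have nn0: "0 \<in> nonneg_vectors r" "ones r \<in> nonneg_vectors r" "ones r \<noteq> 0"
  proof -
    have "Poly_Mapping.lookup (ones r) 0 \<noteq> 0" using r by (simp add: lookup_ones)
    then show "ones r \<noteq> 0" by auto
  qed (auto simp: nonneg_vectors_def int_vectors_iff lookup_ones)
  have "series_quotient r (series_mult ((\<Prod>j<r. t_var j) - 1) ?G) ((\<Prod>j<r. t_var j) - 1) = ?G"
  proof (rule series_quotient_eqI[OF _ _ G refl])
    show "Poly_Mapping.keys ((\<Prod>j<r. t_var j) - 1 :: laurent_poly) \<subseteq> nonneg_vectors r"
      unfolding prod_t_var t_pow_def
      using keys_diff[of "Poly_Mapping.single (ones r) (1::int)" 1] nn0 by auto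
    show "\<bar>Poly_Mapping.lookup ((\<Prod>j<r. t_var j) - 1 :: laurent_poly) 0\<bar> = 1"
      using nn0 by (simp add: prod_t_var t_pow_def lookup_minus lookup_single when_def)
  qed
  moreover have "series_quotient r (Poly_Mapping.lookup 1) (\<Prod>i\<in>UNIV. 1 - t_pow (c i)) = ?G"
  proof (rule series_quotient_eqI[OF _ _ G])
    have "c i \<in> nonneg_vectors r" for i using W(1)[of "axis i 1"] W(3)[of 0 i] W(2) by simp
    from geometric_denominator[of UNIV c, OF finite this c]
    show "Poly_Mapping.keys (\<Prod>i\<in>UNIV. 1 - t_pow (c i)) \<subseteq> nonneg_vectors r"
      "\<bar>Poly_Mapping.lookup (\<Prod>i\<in>UNIV. 1 - t_pow (c i)) 0\<bar> = 1" by auto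
    show "series_mult (\<Prod>i\<in>UNIV. 1 - t_pow (c i)) ?G = Poly_Mapping.lookup 1"
      using series_mult_geometric[OF W(2,3) fin1, of UNIV] by simp
  qed
  ultimately show ?thesis
    using W(1) by (subst poincare_numerator[OF _ fin r]) (auto simp: nonneg_vectors_def)
qed

section \<open>Dimensions of quotients\<close>

text \<open>Gaussian elimination, one equation at a time.\<close>

lemma homogeneous_system_nontrivial_solution:
  fixes c :: "'b \<Rightarrow> 'c \<Rightarrow> complex"
  assumes "finite B'" "finite B" "card B' < card B"
  shows "\<exists>x. (\<exists>b\<in>B. x b \<noteq> 0) \<and> (\<forall>b'\<in>B'. (\<Sum>b\<in>B. x b * c b b') = 0)"
  using assms
proof (induction B' arbitrary: B c rule: finite_induct)
  case empty
  then have "B \<noteq> {}" by auto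
  then show ?case by (intro exI[of _ "\<lambda>_. 1"]) auto
next
  case (insert b0 B')
  show ?case
  proof (cases "\<forall>b\<in>B. c b b0 = 0")
    case True
    have "card B' < card B" using insert by simp
    from insert.IH[OF insert.prems(1) this, of c] show ?thesis using True by auto
  next
    case False
    then obtain p where p: "p \<in> B" "c p b0 \<noteq> 0" by blast
    define c' where "c' = (\<lambda>b b'. c b b' - c b b0 / c p b0 * c p b')"
    have "card B' < card (B - {p})" using insert p by simp
    from insert.IH[OF _ this, of c'] insert.prems(1)
    obtain x where x: "\<exists>b\<in>B - {p}. x b \<noteq> 0" "\<And>b'. b' \<in> B' \<Longrightarrow> (\<Sum>b\<in>B - {p}. x b * c' b b') = 0"
      by auto
    define s where "s = (\<Sum>b\<in>B - {p}. x b * c b b0) / c p b0"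
    define y where "y = x(p := - s)"
    have y: "(\<Sum>b\<in>B. y b * c b b') = (\<Sum>b\<in>B - {p}. x b * c b b') - s * c p b'" for b'
    proof -
      have "(\<Sum>b\<in>B. y b * c b b') = y p * c p b' + (\<Sum>b\<in>B - {p}. y b * c b b')"
        by (rule sum.remove) (use insert.prems p in auto)
      also have "(\<Sum>b\<in>B - {p}. y b * c b b') = (\<Sum>b\<in>B - {p}. x b * c b b')"
        by (rule sum.cong) (auto simp: y_def)
      finally show ?thesis by (simp add: y_def)
    qed
    have "(\<Sum>b\<in>B. y b * c b b') = (\<Sum>b\<in>B - {p}. x b * c' b b')" for b'
    proof -
      have "x b * c' b b' = x b * c b b' - x b * c b b0 * (c p b' / c p b0)" for b
        by (simp add: c'_def right_diff_distrib)
      then show ?thesis unfolding y s_def by (simp add: sum_subtractf sum_distrib_right sum_divide_distrib)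
    qed
    moreover have "(\<Sum>b\<in>B. y b * c b b0) = 0" unfolding y s_def using p by simp
    ultimately have "\<forall>b'\<in>insert b0 B'. (\<Sum>b\<in>B. y b * c b b') = 0" using x(2) by auto
    moreover have "\<exists>b\<in>B. y b \<noteq> 0" using x(1) by (auto simp: y_def)
    ultimately show ?thesis by blast
  qed
qed

definition function_subspace :: "('x \<Rightarrow> complex) set \<Rightarrow> bool" where
  "function_subspace J \<longleftrightarrow> (\<lambda>x. 0) \<in> J \<and> (\<forall>f\<in>J. \<forall>g\<in>J. \<forall>s t. (\<lambda>x. s * f x + t * g x) \<in> J)"

lemma function_subspaceD:
  "function_subspace J \<Longrightarrow> f \<in> J \<Longrightarrow> g \<in> J \<Longrightarrow> (\<lambda>x. s * f x + t * g x) \<in> J"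
  by (simp add: function_subspace_def)

lemma function_subspace_sum:
  assumes J: "function_subspace J" and "finite B" "\<And>b. b \<in> B \<Longrightarrow> f b \<in> J"
  shows "(\<lambda>x. \<Sum>b\<in>B. c b * f b x) \<in> J"
  using assms(2,3)
proof (induction B rule: finite_induct)
  case empty
  then show ?case using J by (simp add: function_subspace_def)
next
  case (insert b B)
  have "(\<lambda>x. c b * f b x + 1 * (\<Sum>b\<in>B. c b * f b x)) \<in> J"
    using insert by (intro function_subspaceD J) auto
  then show ?case using insert(1,2) by simp
qed

lemma quotient_basis_card_le:
  assumes J: "function_subspace J" and B: "quotient_basis I J B" and B': "quotient_basis I J B'"
  shows "card B \<le> card B'"
proof (rule ccontr)
  assume "\<not> card B \<le> card B'"
  then have less: "card B' < card B" by simp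
  have fin: "finite B" "finite B'" using B B' by (auto simp: quotient_basis_def)
  have "\<forall>b\<in>B. \<exists>c. (\<lambda>x. b x - (\<Sum>b'\<in>B'. c b' * b' x)) \<in> J"
    using B B' unfolding quotient_basis_def by blast
  then obtain c where c: "\<And>b. b \<in> B \<Longrightarrow> (\<lambda>x. b x - (\<Sum>b'\<in>B'. c b b' * b' x)) \<in> J"
    by metis
  obtain x where x: "\<exists>b\<in>B. x b \<noteq> 0" "\<And>b'. b' \<in> B' \<Longrightarrow> (\<Sum>b\<in>B. x b * c b b') = 0"
    using homogeneous_system_nontrivial_solution[OF fin(2,1) less, of c] by blast
  have "(\<lambda>y. \<Sum>b\<in>B. x b * (b y - (\<Sum>b'\<in>B'. c b b' * b' y))) \<in> J"
    by (rule function_subspace_sum[OF J fin(1) c])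
  also have "(\<lambda>y. \<Sum>b\<in>B. x b * (b y - (\<Sum>b'\<in>B'. c b b' * b' y))) = (\<lambda>y. \<Sum>b\<in>B. x b * b y)"
  proof
    fix y
    have "(\<Sum>b\<in>B. x b * (\<Sum>b'\<in>B'. c b b' * b' y)) = (\<Sum>b'\<in>B'. (\<Sum>b\<in>B. x b * c b b') * b' y)"
      by (subst sum_distrib_left, subst sum.swap) (simp add: sum_distrib_right mult.assoc)
    also have "\<dots> = 0" using x(2) by simp
    finally show "(\<Sum>b\<in>B. x b * (b y - (\<Sum>b'\<in>B'. c b b' * b' y))) = (\<Sum>b\<in>B. x b * b y)"
      by (simp add: right_diff_distrib sum_subtractf)
  qed
  finally have "\<forall>b\<in>B. x b = 0" using B unfolding quotient_basis_def by blast
  then show False using x(1) by blast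
qed

lemma quotient_dim_eqI:
  assumes J: "function_subspace J" and B: "quotient_basis I J B"
  shows "quotient_dim I J = card B"
  unfolding quotient_dim_def
proof (rule the_equality)
  show "\<exists>B'. quotient_basis I J B' \<and> card B' = card B" using B by blast
  fix n assume "\<exists>B'. quotient_basis I J B' \<and> card B' = n"
  then obtain B' where B': "quotient_basis I J B'" "card B' = n" by blast
  then show "n = card B" using quotient_basis_card_le[OF J B B'(1)] quotient_basis_card_le[OF J B'(1) B] by simp
qed

section \<open>The filtration in terms of monomials\<close>

lemma expansion_at_lincomb:
  assumes f: "expansion_at p f a \<rho>" and g: "expansion_at p g b \<sigma>"
  shows "expansion_at p (\<lambda>z. s * f z + t * g z) (\<lambda>\<alpha>. s * a \<alpha> + t * b \<alpha>) (min \<rho> \<sigma>)"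
proof -
  have "((\<lambda>\<alpha>. (s * a \<alpha> + t * b \<alpha>) * mpow z \<alpha>) has_sum (s * f (p + z) + t * g (p + z))) UNIV"
    if "\<forall>i. norm (z $ i) < min \<rho> \<sigma>" for z
  proof -
    have "((\<lambda>\<alpha>. s * (a \<alpha> * mpow z \<alpha>) + t * (b \<alpha> * mpow z \<alpha>)) has_sum (s * f (p + z) + t * g (p + z))) UNIV"
      using that by (intro has_sum_add has_sum_cmult_right expansion_atD(2)[OF f] expansion_atD(2)[OF g]) auto
    then show ?thesis by (simp add: algebra_simps)
  qed
  then show ?thesis using expansion_atD(1)[OF f] expansion_atD(1)[OF g] by (simp add: expansion_at_def)
qed

lemma expansion_at_polynomial:
  assumes "finite S"
  shows "expansion_at 0 (\<lambda>z. \<Sum>\<alpha>\<in>S. c \<alpha> * mpow z \<alpha>) (\<lambda>\<alpha>. if \<alpha> \<in> S then c \<alpha> else 0) 1"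
proof -
  have "((\<lambda>\<alpha>. (if \<alpha> \<in> S then c \<alpha> else 0) * mpow z \<alpha>) has_sum (\<Sum>\<alpha>\<in>S. c \<alpha> * mpow z \<alpha>)) UNIV" for z
    by (rule has_sum_finite_neutralI[where B = S]) (use assms in auto)
  then show ?thesis by (simp add: expansion_at_def)
qed

lemma mpow_inject:
  fixes \<alpha> \<beta> :: "nat ^ 'd::finite"
  assumes "(\<lambda>z. mpow z \<alpha>) = (\<lambda>z. mpow z \<beta>)"
  shows "\<alpha> = \<beta>"
proof -
  have "mpow z \<alpha> = mpow z \<beta>" for z using assms by metis
  then have "expansion_at 0 (\<lambda>z. 0) (\<lambda>\<gamma>. 1 * (if \<gamma> = \<alpha> then 1 else 0) + (- 1) * (if \<gamma> = \<beta> then 1 else 0)) (min 1 1)"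
    using expansion_at_lincomb[OF expansion_at_mpow[of \<alpha>] expansion_at_mpow[of \<beta>], of 1 "- 1"] by simp
  from expansion_at_zero[OF this, of \<alpha>] show ?thesis by (auto split: if_splits)
qed

lemma valuation_weightsD:
  assumes "valuation_weights C w" "j < length C"
  shows "w j i \<ge> 1"
    and "expansion_at 0 g a \<rho> \<Longrightarrow>
      enat n \<le> divisorial_valuation C j g \<longleftrightarrow> (\<forall>\<alpha>. a \<alpha> \<noteq> 0 \<longrightarrow> n \<le> (\<Sum>i\<in>UNIV. w j i * \<alpha> $ i))"
  using assms unfolding valuation_weights_def by blast+

lemma filtration_ideal_iff:
  assumes w: "valuation_weights C w" and g: "expansion_at 0 g a \<rho>"
  shows "g \<in> filtration_ideal C v \<longleftrightarrow>
    (\<forall>\<alpha>. a \<alpha> \<noteq> 0 \<longrightarrow> (\<forall>j<length C. nat (Poly_Mapping.lookup v j) \<le> (\<Sum>i\<in>UNIV. w j i * \<alpha> $ i)))"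
proof -
  have "analytic_at_pt 0 g" using g by (auto simp: analytic_iff_expansion)
  moreover have "enat n \<le> divisorial_valuation C j g \<longleftrightarrow> (\<forall>\<alpha>. a \<alpha> \<noteq> 0 \<longrightarrow> n \<le> (\<Sum>i\<in>UNIV. w j i * \<alpha> $ i))"
    if "j < length C" for j n
    by (rule valuation_weightsD(2)[OF w that g])
  ultimately show ?thesis unfolding filtration_ideal_def by auto
qed

lemma filtration_ideal_subspace:
  assumes w: "valuation_weights C w"
  shows "function_subspace (filtration_ideal C v)"
  unfolding function_subspace_def
proof (intro conjI ballI allI)
  have "expansion_at 0 (\<lambda>z. 0) (\<lambda>\<alpha>. 0) 1" by (simp add: expansion_at_def)
  from filtration_ideal_iff[OF w this] show "(\<lambda>x. 0) \<in> filtration_ideal C v" by simp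
next
  fix f g s t assume fg: "f \<in> filtration_ideal C v" "g \<in> filtration_ideal C v"
  obtain a \<rho> b \<sigma> where a: "expansion_at 0 f a \<rho>" and b: "expansion_at 0 g b \<sigma>"
    using fg unfolding filtration_ideal_def analytic_iff_expansion by blast
  show "(\<lambda>x. s * f x + t * g x) \<in> filtration_ideal C v"
    unfolding filtration_ideal_iff[OF w expansion_at_lincomb[OF a b]]
  proof (intro allI impI)
    fix \<alpha> j assume "s * a \<alpha> + t * b \<alpha> \<noteq> 0" "j < length C"
    moreover from this(1) have "a \<alpha> \<noteq> 0 \<or> b \<alpha> \<noteq> 0" by auto
    ultimately show "nat (Poly_Mapping.lookup v j) \<le> (\<Sum>i\<in>UNIV. w j i * \<alpha> $ i)"
      using fg unfolding filtration_ideal_iff[OF w a] filtration_ideal_iff[OF w b] by blast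
  qed
qed

lemma finite_bounded_weight:
  fixes w :: "'d::finite \<Rightarrow> nat"
  assumes w: "\<And>i. w i \<ge> 1"
  shows "finite {\<alpha> :: nat ^ 'd. (\<Sum>i\<in>UNIV. w i * \<alpha> $ i) \<le> n}"
proof (rule finite_subset)
  show "{\<alpha> :: nat ^ 'd. (\<Sum>i\<in>UNIV. w i * \<alpha> $ i) \<le> n} \<subseteq> vec_lambda ` PiE UNIV (\<lambda>_. {..n})"
  proof
    fix \<alpha> :: "nat ^ 'd" assume \<alpha>: "\<alpha> \<in> {\<alpha>. (\<Sum>i\<in>UNIV. w i * \<alpha> $ i) \<le> n}"
    have "\<alpha> $ i \<le> n" for i
    proof -
      have "\<alpha> $ i \<le> w i * \<alpha> $ i" using w[of i] by simp
      also have "\<dots> \<le> (\<Sum>i\<in>UNIV. w i * \<alpha> $ i)" by (rule member_le_sum) auto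
      finally show ?thesis using \<alpha> by simp
    qed
    then have "(\<lambda>i. \<alpha> $ i) \<in> PiE UNIV (\<lambda>_. {..n})" by auto
    then show "\<alpha> \<in> vec_lambda ` PiE UNIV (\<lambda>_. {..n})" by (metis imageI vec_lambda_eta)
  qed
qed (auto intro!: finite_PiE)

text \<open>The monomials that belong to the first space and not to the second represent a basis of the quotient.
  The conditions \<open>v\<^sub>j \<le> (W \<alpha>)\<^sub>j\<close> and not \<open>v\<^sub>j + 1 \<le> (W \<alpha>)\<^sub>j\<close> hold together exactly if equality
  holds. Truncating a negative \<open>v\<^sub>j\<close> to \<open>0\<close> does not change them, as \<open>W \<alpha>\<close> is nonnegative.\<close>

lemma quotient_dim_filtration:
  fixes C :: "(complex ^ 'd::finite) bl_point list"
  assumes w: "valuation_weights C w"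
  shows "quotient_dim (filtration_ideal C v) (filtration_ideal C (v + ones (length C))) =
    card {\<alpha>. (\<forall>j<length C. Poly_Mapping.lookup v j \<le> int (\<Sum>i\<in>UNIV. w j i * \<alpha> $ i)) \<and>
             (\<exists>j<length C. Poly_Mapping.lookup v j = int (\<Sum>i\<in>UNIV. w j i * \<alpha> $ i))}" (is "_ = card ?S")
proof -
  let ?I = "filtration_ideal C v" and ?J = "filtration_ideal C (v + ones (length C))"
  define m :: "nat ^ 'd \<Rightarrow> complex ^ 'd \<Rightarrow> complex" where "m = (\<lambda>\<alpha> z. mpow z \<alpha>)"
  have w1: "w j i \<ge> 1" if "j < length C" for j i using that by (rule valuation_weightsD(1)[OF w])
  have fin: "finite ?S"
  proof (rule finite_subset)
    show "?S \<subseteq> (\<Union>j\<in>{..<length C}. {\<alpha>. (\<Sum>i\<in>UNIV. w j i * \<alpha> $ i) \<le> nat (Poly_Mapping.lookup v j)})"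
    proof
      fix \<alpha> assume "\<alpha> \<in> ?S"
      then obtain j where j: "j < length C" "Poly_Mapping.lookup v j = int (\<Sum>i\<in>UNIV. w j i * \<alpha> $ i)" by blast
      have "(\<Sum>i\<in>UNIV. w j i * \<alpha> $ i) \<le> nat (Poly_Mapping.lookup v j)" unfolding j(2) by (simp only: nat_int)
      then show "\<alpha> \<in> (\<Union>j\<in>{..<length C}. {\<alpha>. (\<Sum>i\<in>UNIV. w j i * \<alpha> $ i) \<le> nat (Poly_Mapping.lookup v j)})"
        using j(1) by blast
    qed
    show "finite (\<Union>j\<in>{..<length C}. {\<alpha>. (\<Sum>i\<in>UNIV. w j i * \<alpha> $ i) \<le> nat (Poly_Mapping.lookup v j)})"
      using w1 by (intro finite_UN_I finite_bounded_weight) auto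
  qed
  have S: "\<alpha> \<in> ?S \<longleftrightarrow> (\<forall>j<length C. nat (Poly_Mapping.lookup v j) \<le> (\<Sum>i\<in>UNIV. w j i * \<alpha> $ i)) \<and>
      \<not> (\<forall>j<length C. nat (Poly_Mapping.lookup (v + ones (length C)) j) \<le> (\<Sum>i\<in>UNIV. w j i * \<alpha> $ i))" for \<alpha>
  proof -
    define y where "y j = (\<Sum>i\<in>UNIV. w j i * \<alpha> $ i)" for j
    have "nat (Poly_Mapping.lookup (v + ones (length C)) j) \<le> y j \<longleftrightarrow> Poly_Mapping.lookup v j < int (y j)"
      if "j < length C" for j
      using that by (auto simp: lookup_add lookup_ones nat_le_iff)
    then have "(\<forall>j<length C. nat (Poly_Mapping.lookup (v + ones (length C)) j) \<le> y j) \<longleftrightarrow>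
        (\<forall>j<length C. Poly_Mapping.lookup v j < int (y j))" by blast
    then show ?thesis unfolding mem_Collect_eq y_def[symmetric] nat_le_iff less_le by blast
  qed
  define T where "T = ?S"
  note fin = fin[folded T_def] and S = S[folded T_def]
  have inj: "inj_on m T"
    unfolding m_def by (rule inj_onI) (rule mpow_inject)
  have "quotient_basis ?I ?J (m ` T)"
    unfolding quotient_basis_def
  proof (intro conjI allI impI ballI)
    show "finite (m ` T)" using fin by simp
    show "m ` T \<subseteq> ?I"
    proof
      fix b assume "b \<in> m ` T"
      then obtain \<alpha> where \<alpha>: "\<alpha> \<in> T" "b = m \<alpha>" by blast
      show "b \<in> ?I"
        unfolding \<alpha>(2) m_def filtration_ideal_iff[OF w expansion_at_mpow] using \<alpha>(1) unfolding S
        by (simp split: if_splits)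
    qed
  next
    fix c b assume J: "(\<lambda>x. \<Sum>b\<in>m ` T. c b * b x) \<in> ?J" and "b \<in> m ` T"
    then obtain \<alpha> where \<alpha>: "\<alpha> \<in> T" "b = m \<alpha>" by blast
    have "(\<lambda>x. \<Sum>b\<in>m ` T. c b * b x) = (\<lambda>x. \<Sum>\<alpha>\<in>T. c (m \<alpha>) * mpow x \<alpha>)"
      unfolding sum.reindex[OF inj] by (simp add: m_def o_def)
    with J have "(\<lambda>x. \<Sum>\<alpha>\<in>T. c (m \<alpha>) * mpow x \<alpha>) \<in> ?J" by simp
    then show "c b = 0"
      unfolding filtration_ideal_iff[OF w expansion_at_polynomial[OF fin]] using \<alpha> S[of \<alpha>] by (metis (full_types))
  next
    fix g assume g: "g \<in> ?I"
    then obtain a \<rho> where a: "expansion_at 0 g a \<rho>"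
      unfolding filtration_ideal_def analytic_iff_expansion by blast
    define c where "c = (\<lambda>b. a (inv_into T m b))"
    have "(\<lambda>x. g x - (\<Sum>b\<in>m ` T. c b * b x)) = (\<lambda>x. 1 * g x + (- 1) * (\<Sum>\<alpha>\<in>T. a \<alpha> * mpow x \<alpha>))"
      unfolding sum.reindex[OF inj] c_def using inv_into_f_f[OF inj] by (simp add: m_def o_def)
    also have "\<dots> \<in> ?J"
      unfolding filtration_ideal_iff[OF w expansion_at_lincomb[OF a expansion_at_polynomial[OF fin]]]
    proof (intro allI impI)
      fix \<alpha> j assume \<alpha>: "1 * a \<alpha> + (- 1) * (if \<alpha> \<in> T then a \<alpha> else 0) \<noteq> 0" and j: "j < length C"
      then have "a \<alpha> \<noteq> 0" "\<alpha> \<notin> T" by (auto split: if_splits)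
      then show "nat (Poly_Mapping.lookup (v + ones (length C)) j) \<le> (\<Sum>i\<in>UNIV. w j i * \<alpha> $ i)"
        using g j S[of \<alpha>] unfolding filtration_ideal_iff[OF w a] by blast
    qed
    finally show "\<exists>c. (\<lambda>x. g x - (\<Sum>b\<in>m ` T. c b * b x)) \<in> ?J" by blast
  qed
  then have "quotient_dim ?I ?J = card (m ` T)" by (rule quotient_dim_eqI[OF filtration_ideal_subspace[OF w]])
  also have "\<dots> = card T" by (rule card_image[OF inj])
  finally show ?thesis unfolding T_def .
qed

lemma L_matrix_eq_weight:
  assumes w: "valuation_weights C w" and j: "j < length C"
  shows "L_matrix C j i = w j i"
proof -
  have "expansion_at 0 (\<lambda>z. z $ i) (\<lambda>\<alpha>. if \<alpha> = axis i 1 then 1 else 0) 1"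
    using expansion_at_mpow[of "axis i 1"] by (simp only: mpow_axis)
  note le = valuation_weightsD(2)[OF w j this]
  have sum: "(\<Sum>k\<in>UNIV. w j k * (axis i 1 :: nat ^ 'a) $ k) = w j i"
  proof -
    have "(\<Sum>k\<in>UNIV. w j k * (axis i 1 :: nat ^ 'a) $ k) = (\<Sum>k\<in>UNIV. if k = i then w j k else 0)"
      by (rule sum.cong) (auto simp: axis_def)
    then show ?thesis by simp
  qed
  have le: "enat n \<le> divisorial_valuation C j (\<lambda>z. z $ i) \<longleftrightarrow> n \<le> w j i" for n
    unfolding le by (auto simp: sum simp del: One_nat_def)
  have "divisorial_valuation C j (\<lambda>z. z $ i) = enat (w j i)"
  proof (cases "divisorial_valuation C j (\<lambda>z. z $ i)")
    case (enat k)
    then show ?thesis using le[of k] le[of "w j i"] by simp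
  next
    case infinity
    then show ?thesis using le[of "Suc (w j i)"] by simp
  qed
  then show ?thesis by (simp add: L_matrix_def)
qed

theorem mainTheorem6:
  fixes C :: "(complex ^ ('d::finite)) bl_point list"
  assumes "CARD('d) \<ge> 2"
    and "toric_constellation C"
  shows "poincare_series C =
    series_quotient (length C) (Poly_Mapping.lookup 1) (\<Prod>i\<in>UNIV. 1 - t_pow (L_column C i))"
proof -
  let ?r = "length C"
  have r: "?r > 0" using assms(2) by (simp add: toric_constellation_def)
  obtain w where w: "valuation_weights C w" using valuation_weights_exist[OF assms] by blast
  have w1: "w j i \<ge> 1" if "j < ?r" for j i using that by (rule valuation_weightsD(1)[OF w])
  define W :: "nat ^ 'd \<Rightarrow> ivec" where
    "W = (\<lambda>\<alpha>. \<Sum>j<?r. Poly_Mapping.single j (int (\<Sum>i\<in>UNIV. w j i * \<alpha> $ i)))"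
  have W: "Poly_Mapping.lookup (W \<alpha>) j = (if j < ?r then int (\<Sum>i\<in>UNIV. w j i * \<alpha> $ i) else 0)" for \<alpha> j
    by (simp add: W_def lookup_sum lookup_single when_def del: of_nat_sum)
  have col: "Poly_Mapping.lookup (L_column C i) j = (if j < ?r then int (w j i) else 0)" for i j
    by (simp add: L_column_def lookup_sum lookup_single when_def L_matrix_eq_weight[OF w])
  have "series_quotient ?r (series_mult (\<Prod>j<?r. t_var j - 1) (\<lambda>v. if v \<in> int_vectors ?r then
       int (card {\<alpha>. (\<forall>j<?r. Poly_Mapping.lookup v j \<le> Poly_Mapping.lookup (W \<alpha>) j) \<and>
                     (\<exists>j<?r. Poly_Mapping.lookup v j = Poly_Mapping.lookup (W \<alpha>) j)}) else 0))
       ((\<Prod>j<?r. t_var j) - 1) =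
     series_quotient ?r (Poly_Mapping.lookup 1) (\<Prod>i\<in>UNIV. 1 - t_pow (L_column C i))"
  proof (rule poincare_quotient[OF _ _ _ _ _ r])
    show "W \<alpha> \<in> nonneg_vectors ?r" for \<alpha>
      by (simp add: nonneg_vectors_def int_vectors_iff W del: of_nat_sum)
    show "W 0 = 0" by (rule poly_mapping_eqI) (simp add: W)
    show "W (\<alpha> + axis i 1) = W \<alpha> + L_column C i" for \<alpha> i
    proof (rule poly_mapping_eqI)
      fix j
      have "(\<Sum>k\<in>UNIV. w j k * (\<alpha> + axis i 1) $ k) = (\<Sum>k\<in>UNIV. w j k * \<alpha> $ k + (if k = i then w j k else 0))"
        by (rule sum.cong) (auto simp: axis_def distrib_left)
      then show "Poly_Mapping.lookup (W (\<alpha> + axis i 1)) j = Poly_Mapping.lookup (W \<alpha> + L_column C i) j"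
        by (simp only: W lookup_add col) (simp add: sum.distrib)
    qed
    show "L_column C i \<noteq> 0" for i
    proof
      assume "L_column C i = 0"
      then have "Poly_Mapping.lookup (L_column C i) 0 = 0" by simp
      then show False using r w1[of 0 i] by (simp add: col)
    qed
    show "finite {\<alpha>. Poly_Mapping.lookup (W \<alpha>) j = n}" if "j < ?r" for j n
      by (rule finite_subset[OF _ finite_bounded_weight[OF w1[OF that], where n = "nat n"]])
        (use that in \<open>auto simp: W simp del: of_nat_sum\<close>)
  qed
  moreover have "L_series C = (\<lambda>v. if v \<in> int_vectors ?r then
       int (card {\<alpha>. (\<forall>j<?r. Poly_Mapping.lookup v j \<le> Poly_Mapping.lookup (W \<alpha>) j) \<and>
                     (\<exists>j<?r. Poly_Mapping.lookup v j = Poly_Mapping.lookup (W \<alpha>) j)}) else 0)"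
  proof -
    have "(\<forall>j<?r. Poly_Mapping.lookup v j \<le> int (\<Sum>i\<in>UNIV. w j i * \<alpha> $ i)) \<and>
          (\<exists>j<?r. Poly_Mapping.lookup v j = int (\<Sum>i\<in>UNIV. w j i * \<alpha> $ i)) \<longleftrightarrow>
        (\<forall>j<?r. Poly_Mapping.lookup v j \<le> Poly_Mapping.lookup (W \<alpha>) j) \<and>
          (\<exists>j<?r. Poly_Mapping.lookup v j = Poly_Mapping.lookup (W \<alpha>) j)" for v \<alpha>
      by (auto simp: W simp del: of_nat_sum)
    then show ?thesis unfolding L_series_def quotient_dim_filtration[OF w] by (simp only:)
  qed
  ultimately show ?thesis unfolding poincare_series_def by simp
qed
end
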